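(* If there is an output-polynomial time algorithm for enumerating all globally minimal defensive alliances of bipartite graphs, then there is an output-polynomial time algorithm for enumerating all (inclusion-wise) minimal dominating sets of general connected graphs.
   Context: Graphs are finite, simple and undirected. For $G=(V,E)$, $X\subseteq V$ and $v\in V$, $\deg_X(v)$ is the number of neighbors of $v$ in $X$, and $\overline{X}=V\setminus X$. A set $A\subseteq V$ is a defensive alliance if $\deg_A(v)+1\ge \deg_{\overline{A}}(v)$ for every $v\in A$. A non-empty defensive alliance is globally minimal if no proper subset of it is a non-empty defensive alliance. An enumeration algorithm (which outputs every solution exactly once) runs in output-polynomial time if its total running time is bounded by a polynomial in the input size and the number of solutions. *)

theory Defs
  imports
    "Graph_Theory.Digraph_Component"
    "HOL-Computational_Algebra.Polynomial"
begin

section \<open>Model of computation\<close>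

text \<open>
  Algorithms are programs of the WHILE language of N. D. Jones (Computability and Complexity
  from a Programming Perspective, 1997): an imperative language over binary trees with one atom
  (pure Lisp data), with the same unit costs for its primitive operations.  A primitive operation
  copies pointers only and creates at most one cell, so a computation of cost \<open>t\<close> is simulated on
  a Turing machine, with the data kept as a heap of shared cells, in time polynomial in \<open>t\<close> and the
  input size, and conversely a multi-tape Turing machine is simulated with constant slowdown.
  Writing out a shared output takes no more than polynomial time either, as the output of an
  enumeration below is polynomial in the input size and the number of solutions.
  The notion of output-polynomial time is therefore the usual one.
\<close>

datatype data = Atom | Cell data data

primrec left :: "data \<Rightarrow> data" where
  "left Atom = Atom"
| "left (Cell a b) = a"

primrec right :: "data \<Rightarrow> data" where
  "right Atom = Atom"
| "right (Cell a b) = b"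

datatype expr = Var nat | Const_Atom | Mk_Cell expr expr | Left expr | Right expr

type_synonym store = "nat \<Rightarrow> data"

primrec eval_expr :: "expr \<Rightarrow> store \<Rightarrow> data" where
  "eval_expr (Var x) s = s x"
| "eval_expr Const_Atom s = Atom"
| "eval_expr (Mk_Cell e f) s = Cell (eval_expr e s) (eval_expr f s)"
| "eval_expr (Left e) s = left (eval_expr e s)"
| "eval_expr (Right e) s = right (eval_expr e s)"

primrec cost_expr :: "expr \<Rightarrow> nat" where
  "cost_expr (Var x) = 1"
| "cost_expr Const_Atom = 1"
| "cost_expr (Mk_Cell e f) = cost_expr e + cost_expr f + 1"
| "cost_expr (Left e) = cost_expr e + 1"
| "cost_expr (Right e) = cost_expr e + 1"

datatype program =
    Skip
  | Assign nat expr
  | Seq program program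
  | Cond expr program program
  | While expr program

text \<open>
  \<open>exec c s t s'\<close>: started in store \<open>s\<close>, program \<open>c\<close> halts in store \<open>s'\<close> after time \<open>t\<close>.
  A guard holds iff its value is not the atom.
\<close>

inductive exec :: "program \<Rightarrow> store \<Rightarrow> nat \<Rightarrow> store \<Rightarrow> bool" where
  Skip: "exec Skip s 1 s"
| Assign: "exec (Assign x e) s (cost_expr e + 1) (s(x := eval_expr e s))"
| Seq: "exec c s t s' \<Longrightarrow> exec d s' t' s'' \<Longrightarrow> exec (Seq c d) s (t + t') s''"
| Cond_True: "eval_expr e s \<noteq> Atom \<Longrightarrow> exec c s t s'
    \<Longrightarrow> exec (Cond e c d) s (cost_expr e + 1 + t) s'"
| Cond_False: "eval_expr e s = Atom \<Longrightarrow> exec d s t s'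
    \<Longrightarrow> exec (Cond e c d) s (cost_expr e + 1 + t) s'"
| While_True: "eval_expr e s \<noteq> Atom \<Longrightarrow> exec c s t s' \<Longrightarrow> exec (While e c) s' t' s''
    \<Longrightarrow> exec (While e c) s (cost_expr e + 1 + t + t') s''"
| While_False: "eval_expr e s = Atom \<Longrightarrow> exec (While e c) s (cost_expr e + 1) s"

text \<open>Variable 0 holds the input at the start and the output at the end.\<close>

definition initial_store :: "data \<Rightarrow> store" where
  "initial_store d = (\<lambda>_. Atom)(0 := d)"

definition computes_in_time :: "program \<Rightarrow> data \<Rightarrow> data \<Rightarrow> nat \<Rightarrow> bool" where
  "computes_in_time c d d' t \<longleftrightarrow> (\<exists>s. exec c (initial_store d) t s \<and> s 0 = d')"

definition list_data :: "data list \<Rightarrow> data" where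
  "list_data ds = foldr Cell ds Atom"

definition bit_data :: "bool \<Rightarrow> data" where
  "bit_data b = (if b then Cell Atom Atom else Atom)"


section \<open>Enumeration in output-polynomial time\<close>

text \<open>
  An enumeration problem consists of a set \<open>I\<close> of instances with encoding \<open>enc\<close>, and for each
  instance \<open>x\<close> a finite set \<open>sol x\<close> of solutions with encoding \<open>enc_sol x\<close>.  The output of the
  algorithm is the list of all solutions in some order, each occurring once.  The polynomial \<open>p\<close> is
  bivariate; \<open>size\<close> counts the cells of a tree.
\<close>

definition output_polynomial_enumeration ::
  "'i set \<Rightarrow> ('i \<Rightarrow> data) \<Rightarrow> ('i \<Rightarrow> 's set) \<Rightarrow> ('i \<Rightarrow> 's \<Rightarrow> data) \<Rightarrow> program \<Rightarrow> bool" where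
  "output_polynomial_enumeration I enc sol enc_sol c \<longleftrightarrow>
     (\<exists>p :: nat poly poly. \<forall>x\<in>I. \<exists>ys t.
        distinct ys \<and> set ys = sol x \<and>
        computes_in_time c (enc x) (list_data (map (enc_sol x) ys)) t \<and>
        t \<le> poly (poly p [:card (sol x):]) (size (enc x)))"


section \<open>Graphs\<close>

text \<open>
  A finite simple undirected graph is a symmetric loop-free finite digraph without parallel arcs
  (\<open>pair_graph\<close>), each edge being a pair of opposite arcs.
\<close>

definition bipartite :: "'a pair_pre_digraph \<Rightarrow> bool" where
  "bipartite G \<longleftrightarrow> (\<exists>X Y. X \<union> Y = pverts G \<and> X \<inter> Y = {} \<and> parcs G \<subseteq> X \<times> Y \<union> Y \<times> X)"

definition deg_in :: "'a pair_pre_digraph \<Rightarrow> 'a set \<Rightarrow> 'a \<Rightarrow> nat" where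
  "deg_in G X v = card {w \<in> X. (v, w) \<in> parcs G}"

definition defensive_alliance :: "'a pair_pre_digraph \<Rightarrow> 'a set \<Rightarrow> bool" where
  "defensive_alliance G A \<longleftrightarrow>
     A \<subseteq> pverts G \<and> (\<forall>v\<in>A. deg_in G A v + 1 \<ge> deg_in G (pverts G - A) v)"

definition globally_minimal_defensive_alliance :: "'a pair_pre_digraph \<Rightarrow> 'a set \<Rightarrow> bool" where
  "globally_minimal_defensive_alliance G A \<longleftrightarrow>
     A \<noteq> {} \<and> defensive_alliance G A \<and>
     \<not> (\<exists>B. B \<subset> A \<and> B \<noteq> {} \<and> defensive_alliance G B)"

definition dominating_set :: "'a pair_pre_digraph \<Rightarrow> 'a set \<Rightarrow> bool" where
  "dominating_set G D \<longleftrightarrow>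
     D \<subseteq> pverts G \<and> (\<forall>v\<in>pverts G - D. \<exists>w\<in>D. (v, w) \<in> parcs G)"

definition minimal_dominating_set :: "'a pair_pre_digraph \<Rightarrow> 'a set \<Rightarrow> bool" where
  "minimal_dominating_set G D \<longleftrightarrow>
     dominating_set G D \<and> \<not> (\<exists>D'. D' \<subset> D \<and> dominating_set G D')"

text \<open>
  As inputs of algorithms, graphs have vertices \<open>0, \<dots>, n - 1\<close> and are given by their adjacency
  matrix; a vertex set is given by its characteristic vector.
\<close>

definition input_graph :: "nat pair_pre_digraph \<Rightarrow> bool" where
  "input_graph G \<longleftrightarrow> pair_graph G \<and> (\<exists>n. pverts G = {..<n})"

definition graph_data :: "nat pair_pre_digraph \<Rightarrow> data" where
  "graph_data G =
     (let vs = [0..<card (pverts G)]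
      in list_data (map (\<lambda>u. list_data (map (\<lambda>v. bit_data ((u, v) \<in> parcs G)) vs)) vs))"

definition vertex_set_data :: "nat pair_pre_digraph \<Rightarrow> nat set \<Rightarrow> data" where
  "vertex_set_data G X = list_data (map (\<lambda>v. bit_data (v \<in> X)) [0..<card (pverts G)])"

definition output_polynomial_vertex_set_enumeration ::
  "(nat pair_pre_digraph \<Rightarrow> bool) \<Rightarrow> (nat pair_pre_digraph \<Rightarrow> nat set \<Rightarrow> bool) \<Rightarrow> program \<Rightarrow> bool"
where
  "output_polynomial_vertex_set_enumeration P S c \<longleftrightarrow>
     output_polynomial_enumeration {G. input_graph G \<and> P G} graph_data (\<lambda>G. {X. S G X})
       vertex_set_data c"

end

theory Submission
  imports Defs
begin

text \<open>
  From a graph \<open>G\<close> on \<open>n\<close> vertices build a bipartite graph whose core consists of elements \<open>u\<^sub>i\<close>,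
  constraints \<open>c\<^sub>v\<close>, forced vertices \<open>f\<^sub>i\<close> and a hub; \<open>c\<^sub>v\<close> is adjacent to \<open>u\<^sub>w\<close> for \<open>w\<close> in the closed
  neighbourhood \<open>N[v]\<close> and to all \<open>f\<^sub>i\<close>, and the hub is adjacent to all \<open>f\<^sub>i\<close>.  Attached leaves tune
  the demands: inside a leafless alliance a hub or \<open>f\<^sub>i\<close> needs all its core neighbours, \<open>c\<^sub>v\<close> needs
  \<open>n + 1\<close> of them, and \<open>u\<^sub>i\<close> needs at least one.  As \<open>|N[v]| \<le> n\<close>, every non-empty leafless alliance
  contains all \<open>c\<^sub>v\<close>, all \<open>f\<^sub>i\<close> and the hub, and then the demand of \<open>c\<^sub>v\<close> says that the chosen elements
  meet \<open>N[v]\<close>.  So the globally minimal alliances are the single leaves, which are polynomially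
  many, and one for each minimal dominating set of \<open>G\<close>.
\<close>

section \<open>Polynomial bounds\<close>

text \<open>A constraint taken alone says nothing about the other constraints, so something has to
  tie them together. The \<open>n\<close> forced vertices do this in both directions: the at most
  \<open>n\<close> elements around a constraint cannot meet a demand of \<open>n + 1\<close>, so
  some forced vertex must join; conversely all \<open>n\<close> forced vertices leave exactly one
  neighbour missing, which has to be an element. The hub ties the forced vertices to each other.
  Everything but the elements is then fixed, so inclusion of alliances is inclusion of dominating
  sets. The surplus of leaf solutions is additive, hence listing and discarding them stays
  output-polynomial. The larger part of the work comes from the model of computation: reduction and
  decoding must exist as WHILE programs. A calculus of polynomial-time functions on trees provides
  them without writing the programs out, while the given enumeration program is used as a black box,
  known to halt only on encodings of bipartite graphs.\<close>

definition poly_bounded :: "'a set \<Rightarrow> ('a \<Rightarrow> nat) \<Rightarrow> ('a \<Rightarrow> nat) \<Rightarrow> bool" where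
  "poly_bounded A \<mu> T \<longleftrightarrow> (\<exists>k. \<forall>x\<in>A. T x \<le> (\<mu> x + 2) ^ k)"

lemma poly_bounded_mono:
  assumes "poly_bounded A \<mu> T" "\<And>x. x \<in> A \<Longrightarrow> S x \<le> T x"
  shows "poly_bounded A \<mu> S"
  using assms unfolding poly_bounded_def by (meson le_trans)

lemma poly_bounded_measure: "poly_bounded A \<mu> \<mu>"
  unfolding poly_bounded_def by (intro exI[of _ 1]) simp

text \<open>The base \<open>\<mu> x + 2\<close> is at least 2, so the exponent alone absorbs every
  constant and no coefficient has to be carried along.\<close>

lemma poly_bounded_const: "poly_bounded A \<mu> (\<lambda>_. c)"
  unfolding poly_bounded_def
proof (intro exI[of _ c] ballI)
  fix x
  have "c \<le> 2 ^ c"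
    by (simp add: less_imp_le)
  also have "\<dots> \<le> (\<mu> x + 2) ^ c"
    by (rule power_mono) auto
  finally show "c \<le> (\<mu> x + 2) ^ c" .
qed

lemma poly_bounded_mult:
  assumes "poly_bounded A \<mu> S" "poly_bounded A \<mu> T"
  shows "poly_bounded A \<mu> (\<lambda>x. S x * T x)"
proof -
  obtain j k where "\<forall>x\<in>A. S x \<le> (\<mu> x + 2) ^ j" "\<forall>x\<in>A. T x \<le> (\<mu> x + 2) ^ k"
    using assms unfolding poly_bounded_def by blast
  then have "\<forall>x\<in>A. S x * T x \<le> (\<mu> x + 2) ^ (j + k)"
    by (simp add: power_add mult_le_mono)
  then show ?thesis
    unfolding poly_bounded_def by blast
qed

lemma poly_bounded_max:
  assumes "poly_bounded A \<mu> S" "poly_bounded A \<mu> T"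
  shows "poly_bounded A \<mu> (\<lambda>x. max (S x) (T x))"
proof -
  obtain j k where jk: "\<forall>x\<in>A. S x \<le> (\<mu> x + 2) ^ j" "\<forall>x\<in>A. T x \<le> (\<mu> x + 2) ^ k"
    using assms unfolding poly_bounded_def by blast
  have "max (S x) (T x) \<le> (\<mu> x + 2) ^ max j k" if "x \<in> A" for x
  proof -
    have "(\<mu> x + 2) ^ j \<le> (\<mu> x + 2) ^ max j k" "(\<mu> x + 2) ^ k \<le> (\<mu> x + 2) ^ max j k"
      by (rule power_increasing; simp)+
    then show ?thesis
      using jk that by (meson le_trans max.bounded_iff)
  qed
  then show ?thesis
    unfolding poly_bounded_def by blast
qed

lemma poly_bounded_add:
  assumes "poly_bounded A \<mu> S" "poly_bounded A \<mu> T"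
  shows "poly_bounded A \<mu> (\<lambda>x. S x + T x)"
  by (rule poly_bounded_mono[OF poly_bounded_mult[OF poly_bounded_const[of _ _ 2]
        poly_bounded_max[OF assms]]]) (auto simp: max_def)

lemma poly_bounded_power:
  assumes "poly_bounded A \<mu> T"
  shows "poly_bounded A \<mu> (\<lambda>x. T x ^ k)"
  by (induction k) (auto intro: poly_bounded_const poly_bounded_mult assms)

text \<open>A bound for the outer function helps only if the intermediate result is small. The
  second hypothesis asks for this, which is why \<open>poly_time\<close> records the size of
  results.\<close>

lemma poly_bounded_comp:
  assumes "poly_bounded UNIV \<nu> T" "poly_bounded A \<mu> (\<lambda>x. \<nu> (g x))"
  shows "poly_bounded A \<mu> (\<lambda>x. T (g x))"
proof -
  obtain k where "\<forall>y. T y \<le> (\<nu> y + 2) ^ k"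
    using assms(1) unfolding poly_bounded_def by blast
  then show ?thesis
    by (intro poly_bounded_mono[OF poly_bounded_power[OF
          poly_bounded_add[OF assms(2) poly_bounded_const[of _ _ 2]]]]) blast
qed

lemmas poly_bounded_intros =
  poly_bounded_measure poly_bounded_const poly_bounded_add poly_bounded_mult

lemma poly_nat_le:
  fixes p :: "nat poly"
  shows "poly p x \<le> poly p 1 * (x + 1) ^ degree p"
proof -
  have "poly p x = (\<Sum>i\<le>degree p. coeff p i * x ^ i)"
    by (simp add: poly_altdef)
  also have "\<dots> \<le> (\<Sum>i\<le>degree p. coeff p i * (x + 1) ^ degree p)"
  proof (intro sum_mono mult_left_mono)
    fix i assume "i \<in> {..degree p}"
    have "x ^ i \<le> (x + 1) ^ i"
      by (rule power_mono) auto
    \<comment> \<open>The shift to \<open>x + 1\<close> makes powers increase with the exponent,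
      also at \<open>x = 0\<close>.\<close>
    also have "\<dots> \<le> (x + 1) ^ degree p"
      using \<open>i \<in> {..degree p}\<close> by (intro power_increasing) auto
    finally show "x ^ i \<le> (x + 1) ^ degree p" .
  qed simp
  also have "\<dots> = poly p 1 * (x + 1) ^ degree p"
    by (simp add: poly_altdef sum_distrib_right)
  finally show ?thesis .
qed

lemma poly_bounded_poly:
  fixes p :: "nat poly"
  assumes "poly_bounded A \<mu> T"
  shows "poly_bounded A \<mu> (\<lambda>x. poly p (T x))"
  by (rule poly_bounded_mono[OF poly_bounded_mult[OF poly_bounded_const
        poly_bounded_power[OF poly_bounded_add[OF assms poly_bounded_const[of _ _ 1]]]]])
    (rule poly_nat_le)

lemma poly_bounded_poly_poly:
  fixes p :: "nat poly poly"
  assumes S: "poly_bounded A \<mu> S" and T: "poly_bounded A \<mu> T"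
  shows "poly_bounded A \<mu> (\<lambda>x. poly (poly p [:S x:]) (T x))"
proof (induction p)
  case 0
  show ?case
    by (simp add: poly_bounded_const)
next
  case (pCons a p)
  then show ?case
    by (simp add: poly_bounded_add poly_bounded_mult poly_bounded_poly S T)
qed

lemma poly_bounded_imp_poly_poly:
  assumes "poly_bounded A (\<lambda>x. m x + s x) T"
  obtains p :: "nat poly poly" where "\<And>x. x \<in> A \<Longrightarrow> T x \<le> poly (poly p [:m x:]) (s x)"
proof -
  obtain k where "\<forall>x\<in>A. T x \<le> (m x + s x + 2) ^ k"
    using assms unfolding poly_bounded_def by blast
  \<comment> \<open>The nested polynomial is the sum of both variables and 2: the outer variable
    takes \<open>m x\<close>, the inner one \<open>s x\<close>.\<close>
  moreover have "poly (poly ([:[:2, 1:], 1:] ^ k) [:m x:]) (s x) = (m x + s x + 2) ^ k" for x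
    by (simp add: poly_power add_ac)
  ultimately show thesis
    by (intro that[of "[:[:2, 1:], 1:] ^ k"]) metis
qed


section \<open>Calling programs as subroutines\<close>

primrec expr_vars :: "expr \<Rightarrow> nat set" where
  "expr_vars (Var x) = {x}"
| "expr_vars Const_Atom = {}"
| "expr_vars (Mk_Cell e f) = expr_vars e \<union> expr_vars f"
| "expr_vars (Left e) = expr_vars e"
| "expr_vars (Right e) = expr_vars e"

primrec program_vars :: "program \<Rightarrow> nat set" where
  "program_vars Skip = {}"
| "program_vars (Assign x e) = insert x (expr_vars e)"
| "program_vars (Seq c d) = program_vars c \<union> program_vars d"
| "program_vars (Cond e c d) = expr_vars e \<union> program_vars c \<union> program_vars d"
| "program_vars (While e c) = expr_vars e \<union> program_vars c"

lemma exec_Assign: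
  "t = cost_expr e + 1 \<Longrightarrow> s' = s(x := eval_expr e s) \<Longrightarrow> exec (Assign x e) s t s'"
  by (simp only: exec.Assign)

lemma finite_expr_vars: "finite (expr_vars e)"
  by (induction e) auto

lemma finite_program_vars: "finite (program_vars c)"
  by (induction c) (auto simp: finite_expr_vars)

lemma eval_expr_cong: "(\<And>x. x \<in> expr_vars e \<Longrightarrow> r x = s x) \<Longrightarrow> eval_expr e r = eval_expr e s"
  by (induction e) auto

text \<open>A program sees only its own variables, so a run from \<open>initial_store\<close> can be
  replayed in a store where a caller keeps further data. \<open>override_on\<close> names the final
  store: the callee's result on \<open>X\<close>, the caller's data elsewhere.\<close>

lemma exec_frame:
  "exec c s t s' \<Longrightarrow> program_vars c \<subseteq> X \<Longrightarrow> (\<And>x. x \<in> X \<Longrightarrow> r x = s x)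
    \<Longrightarrow> exec c r t (override_on r s' X)"
proof (induction arbitrary: r rule: exec.induct)
  case (Skip s)
  then have "override_on r s X = r"
    by (auto simp: override_on_def)
  then show ?case
    using exec.Skip[of r] by simp
next
  case (Assign x e s)
  then have "eval_expr e r = eval_expr e s"
    by (intro eval_expr_cong) auto
  with Assign have "override_on r (s(x := eval_expr e s)) X = r(x := eval_expr e r)"
    by (auto simp: override_on_def fun_eq_iff)
  then show ?case
    by (simp only: exec.Assign)
next
  case (Seq c s t s' d t' s'')
  have "exec d (override_on r s' X) t' (override_on (override_on r s' X) s'' X)"
    by (rule Seq.IH(2)) (use Seq.prems in auto)
  moreover have "override_on (override_on r s' X) s'' X = override_on r s'' X"
    by (auto simp: override_on_def)
  ultimately show ?case
    using Seq by (auto intro: exec.Seq)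
next
  case (Cond_True e s c t s' d)
  moreover have "eval_expr e r = eval_expr e s"
    by (rule eval_expr_cong) (use Cond_True.prems in auto)
  ultimately show ?case
    by (intro exec.Cond_True) auto
next
  case (Cond_False e s d t s' c)
  moreover have "eval_expr e r = eval_expr e s"
    by (rule eval_expr_cong) (use Cond_False.prems in auto)
  ultimately show ?case
    by (intro exec.Cond_False) auto
next
  case (While_True e s c t s' t' s'')
  have "eval_expr e r = eval_expr e s"
    by (rule eval_expr_cong) (use While_True.prems in auto)
  moreover have "exec (While e c) (override_on r s' X) t'
      (override_on (override_on r s' X) s'' X)"
    by (rule While_True.IH(2)) (use While_True.prems in auto)
  moreover have "override_on (override_on r s' X) s'' X = override_on r s'' X"
    by (auto simp: override_on_def)
  ultimately show ?case
    using While_True by (metis exec.While_True le_sup_iff program_vars.simps(5))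
next
  case (While_False e s c)
  moreover have "eval_expr e r = eval_expr e s"
    by (rule eval_expr_cong) (use While_False.prems in auto)
  moreover have "override_on r s X = r"
    using While_False by (auto simp: override_on_def)
  ultimately show ?case
    using exec.While_False[of e r c] by simp
qed

section \<open>Subroutine calls and their combinations\<close>

primrec clear :: "nat \<Rightarrow> program" where
  "clear 0 = Skip"
| "clear (Suc k) = Seq (clear k) (Assign (Suc k) Const_Atom)"

lemma exec_clear: "exec (clear k) s (2 * k + 1) (override_on s (\<lambda>_. Atom) {1..k})"
proof (induction k)
  case 0
  show ?case
    using exec.Skip[of s] by (simp add: override_on_def)
next
  case (Suc k)
  have "override_on s (\<lambda>_. Atom) {1..Suc k} = (override_on s (\<lambda>_. Atom) {1..k})(Suc k := Atom)"
    by (auto simp: override_on_def fun_eq_iff)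
  then show ?case
    using exec.Seq[OF Suc exec_Assign[OF refl refl, of "Suc k" Const_Atom]] by (simp del: fun_upd_apply)
qed

text \<open>Clearing variables 1 to \<open>k\<close> restores what \<open>initial_store\<close>
  prescribes, so calls can follow one another. The caller's data live above \<open>k\<close>, and
  the net effect of a call is one update of variable 0.\<close>

definition call :: "nat \<Rightarrow> program \<Rightarrow> program" where
  "call k c = Seq c (clear k)"

lemma exec_call:
  assumes c: "computes_in_time c x y t" and vars: "program_vars c \<subseteq> {..k}"
    and s: "s 0 = x" "\<And>i. 0 < i \<Longrightarrow> i \<le> k \<Longrightarrow> s i = Atom"
  shows "exec (call k c) s (t + (2 * k + 1)) (s(0 := y))"
proof -
  obtain s' where s': "exec c (initial_store x) t s'" "s' 0 = y"
    using c unfolding computes_in_time_def by blast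
  have "exec c s t (override_on s s' {..k})"
    by (rule exec_frame[OF s'(1) vars]) (use s in \<open>auto simp: initial_store_def\<close>)
  moreover have "override_on (override_on s s' {..k}) (\<lambda>_. Atom) {1..k} = s(0 := y)"
    using s s'(2) by (auto simp: override_on_def fun_eq_iff)
  ultimately show ?thesis
    unfolding call_def using exec.Seq exec_clear by metis
qed

lemma program_vars_bound2:
  obtains k where "program_vars c \<subseteq> {..k}" "program_vars d \<subseteq> {..k}"
  using finite_nat_iff_bounded_le[of "program_vars c \<union> program_vars d"] finite_program_vars
  by (metis finite_UnI le_sup_iff)

lemma program_vars_bound3:
  obtains k where "program_vars b \<subseteq> {..k}" "program_vars c \<subseteq> {..k}" "program_vars d \<subseteq> {..k}"
  by (rule program_vars_bound2[of "Seq b c" d]) (use that in auto)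

text \<open>Stated for single runs instead of functions: the given enumeration program is known to
  halt only on some inputs, and the order of its output is left open. The overhead \<open>K\<close>
  is chosen before the input.\<close>

lemma computes_seq:
  "\<exists>c K. \<forall>x y z t1 t2. computes_in_time c1 x y t1 \<longrightarrow> computes_in_time c2 y z t2
     \<longrightarrow> computes_in_time c x z (t1 + t2 + K)"
proof -
  obtain k where k: "program_vars c1 \<subseteq> {..k}" "program_vars c2 \<subseteq> {..k}"
    by (rule program_vars_bound2)
  have "computes_in_time (Seq (call k c1) (call k c2)) x z (t1 + t2 + (4 * k + 2))"
    if c1: "computes_in_time c1 x y t1" and c2: "computes_in_time c2 y z t2" for x y z t1 t2
  proof -
    have "exec (call k c1) (initial_store x) (t1 + (2 * k + 1)) ((initial_store x)(0 := y))"
      by (rule exec_call[OF c1 k(1)]) (auto simp: initial_store_def)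
    moreover have "exec (call k c2) ((initial_store x)(0 := y)) (t2 + (2 * k + 1))
        ((initial_store x)(0 := y, 0 := z))"
      by (rule exec_call[OF c2 k(2)]) (auto simp: initial_store_def)
    ultimately have "exec (Seq (call k c1) (call k c2)) (initial_store x)
        (t1 + (2 * k + 1) + (t2 + (2 * k + 1))) ((initial_store x)(0 := y, 0 := z))"
      by (rule exec.Seq)
    moreover have "t1 + (2 * k + 1) + (t2 + (2 * k + 1)) = t1 + t2 + (4 * k + 2)"
      by simp
    ultimately show ?thesis
      unfolding computes_in_time_def by (metis fun_upd_same)
  qed
  then show ?thesis
    by blast
qed

lemma computes_pair:
  "\<exists>c K. \<forall>x y z t1 t2. computes_in_time c1 x y t1 \<longrightarrow> computes_in_time c2 x z t2
     \<longrightarrow> computes_in_time c x (Cell y z) (t1 + t2 + K)"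
proof -
  obtain k where k: "program_vars c1 \<subseteq> {..k}" "program_vars c2 \<subseteq> {..k}"
    by (rule program_vars_bound2)
  \<comment> \<open>Both extra variables lie beyond the callees: \<open>k + 1\<close> saves the
    input for the second call, \<open>k + 2\<close> the first result.\<close>
  define c where "c = Seq (Assign (k + 1) (Var 0)) (Seq (call k c1) (Seq (Assign (k + 2) (Var 0))
      (Seq (Assign 0 (Var (k + 1))) (Seq (call k c2) (Assign 0 (Mk_Cell (Var (k + 2)) (Var 0)))))))"
  have "computes_in_time c x (Cell y z) (t1 + t2 + (4 * k + 12))"
    if c1: "computes_in_time c1 x y t1" and c2: "computes_in_time c2 x z t2" for x y z t1 t2
  proof -
    define s1 where "s1 = (initial_store x)(k + 1 := x)"
    define s3 where "s3 = s1(0 := y, k + 2 := y, 0 := x)"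
    have 1: "exec (Assign (k + 1) (Var 0)) (initial_store x) 2 s1"
      by (rule exec_Assign) (auto simp: s1_def initial_store_def)
    have 2: "exec (call k c1) s1 (t1 + (2 * k + 1)) (s1(0 := y))"
      by (rule exec_call[OF c1 k(1)]) (auto simp: s1_def initial_store_def)
    have 3: "exec (Assign (k + 2) (Var 0)) (s1(0 := y)) 2 (s1(0 := y, k + 2 := y))"
      by (rule exec_Assign) auto
    have 4: "exec (Assign 0 (Var (k + 1))) (s1(0 := y, k + 2 := y)) 2 s3"
      by (rule exec_Assign) (auto simp: s1_def s3_def)
    have 5: "exec (call k c2) s3 (t2 + (2 * k + 1)) (s3(0 := z))"
      by (rule exec_call[OF c2 k(2)]) (auto simp: s1_def s3_def initial_store_def)
    have 6: "exec (Assign 0 (Mk_Cell (Var (k + 2)) (Var 0))) (s3(0 := z)) 4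
        (s3(0 := z, 0 := Cell y z))"
      by (rule exec_Assign) (auto simp: s3_def)
    have "exec c (initial_store x)
        (2 + (t1 + (2 * k + 1) + (2 + (2 + (t2 + (2 * k + 1) + 4))))) (s3(0 := z, 0 := Cell y z))"
      unfolding c_def by (intro exec.Seq) (fact 1 2 3 4 5 6)+
    moreover have "2 + (t1 + (2 * k + 1) + (2 + (2 + (t2 + (2 * k + 1) + 4))))
        = t1 + t2 + (4 * k + 12)"
      by simp
    ultimately show ?thesis
      unfolding computes_in_time_def by (metis fun_upd_same)
  qed
  then show ?thesis
    by blast
qed

lemma computes_cond:
  "\<exists>c K. \<forall>x b y t1 t2. computes_in_time c0 x b t1
     \<longrightarrow> computes_in_time (if b \<noteq> Atom then c1 else c2) x y t2
     \<longrightarrow> computes_in_time c x y (t1 + t2 + K)"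
proof -
  obtain k where k: "program_vars c0 \<subseteq> {..k}" "program_vars c1 \<subseteq> {..k}" "program_vars c2 \<subseteq> {..k}"
    by (rule program_vars_bound3)
  define d where "d c = Seq (Assign 0 (Var (k + 1))) (call k c)" for c
  define c where "c = Seq (Assign (k + 1) (Var 0)) (Seq (call k c0) (Cond (Var 0) (d c1) (d c2)))"
  have "computes_in_time c x y (t1 + t2 + (4 * k + 8))"
    if c0: "computes_in_time c0 x b t1"
      and c12: "computes_in_time (if b \<noteq> Atom then c1 else c2) x y t2" for x b y t1 t2
  proof -
    define s1 where "s1 = (initial_store x)(k + 1 := x)"
    have 1: "exec (Assign (k + 1) (Var 0)) (initial_store x) 2 s1"
      by (rule exec_Assign) (auto simp: s1_def initial_store_def)
    have 2: "exec (call k c0) s1 (t1 + (2 * k + 1)) (s1(0 := b))"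
      by (rule exec_call[OF c0 k(1)]) (auto simp: s1_def initial_store_def)
    have "exec (d (if b \<noteq> Atom then c1 else c2)) (s1(0 := b)) (2 + (t2 + (2 * k + 1)))
        (s1(0 := b, 0 := x, 0 := y))"
      unfolding d_def
    proof (rule exec.Seq)
      show "exec (Assign 0 (Var (k + 1))) (s1(0 := b)) 2 (s1(0 := b, 0 := x))"
        by (rule exec_Assign) (auto simp: s1_def)
      show "exec (call k (if b \<noteq> Atom then c1 else c2)) (s1(0 := b, 0 := x)) (t2 + (2 * k + 1))
          (s1(0 := b, 0 := x, 0 := y))"
        by (rule exec_call[OF c12]) (use k in \<open>auto simp: s1_def initial_store_def\<close>)
    qed
    then have "exec (Cond (Var 0) (d c1) (d c2)) (s1(0 := b)) (2 + (2 + (t2 + (2 * k + 1))))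
        (s1(0 := b, 0 := x, 0 := y))"
      using exec.Cond_True[of "Var 0" "s1(0 := b)" "d c1" _ _ "d c2"]
        exec.Cond_False[of "Var 0" "s1(0 := b)" "d c2" _ _ "d c1"]
      by (cases "b = Atom") fastforce+
    then have "exec c (initial_store x) (2 + (t1 + (2 * k + 1) + (2 + (2 + (t2 + (2 * k + 1))))))
        (s1(0 := b, 0 := x, 0 := y))"
      unfolding c_def by (intro exec.Seq[OF 1] exec.Seq[OF 2])
    moreover have "2 + (t1 + (2 * k + 1) + (2 + (2 + (t2 + (2 * k + 1))))) = t1 + t2 + (4 * k + 8)"
      by simp
    ultimately show ?thesis
      unfolding computes_in_time_def by (metis fun_upd_same)
  qed
  then show ?thesis
    by blast
qed

text \<open>Every tree is a list of trees, so that \<open>list_data\<close> is a bijection.\<close>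

primrec data_list :: "data \<Rightarrow> data list" where
  "data_list Atom = []"
| "data_list (Cell a b) = a # data_list b"

lemma list_data_simps [simp]: "list_data [] = Atom" "list_data (a # as) = Cell a (list_data as)"
  by (simp_all add: list_data_def)

lemma data_list_list_data [simp]: "data_list (list_data as) = as"
  by (induction as) auto

lemma list_data_data_list [simp]: "list_data (data_list d) = d"
  by (induction d) auto

lemma list_data_inject [simp]: "list_data as = list_data bs \<longleftrightarrow> as = bs"
  by (metis data_list_list_data)

lemma size_list_data: "size (list_data as) = (\<Sum>a\<leftarrow>as. size a + 1)"
  by (induction as) auto

section \<open>Loops over lists\<close>

lemma exec_fold:
  fixes F :: "data \<Rightarrow> data" and T :: "data \<Rightarrow> nat"
  defines "f \<equiv> \<lambda>e a y. F (Cell e (Cell a y))"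
  defines "body k c \<equiv> Seq (Assign 0 (Mk_Cell (Var (k + 2)) (Mk_Cell (Left (Var (k + 1))) (Var 0))))
      (Seq (Assign (k + 1) (Right (Var (k + 1)))) (call k c))"
  assumes c: "\<And>x. computes_in_time c x (F x) (T x)" and vars: "program_vars c \<subseteq> {..k}"
  shows "s (k + 1) = list_data as \<Longrightarrow> s (k + 2) = e \<Longrightarrow> (\<And>i. 0 < i \<Longrightarrow> i \<le> k \<Longrightarrow> s i = Atom)
    \<Longrightarrow> (\<And>i. i < length as \<Longrightarrow> T (Cell e (Cell (as ! i) (fold (f e) (take i as) (s 0)))) \<le> B)
    \<Longrightarrow> \<exists>t s'. exec (While (Var (k + 1)) (body k c)) s t s' \<and> t \<le> length as * (B + 2 * k + 13) + 2
          \<and> s' 0 = fold (f e) as (s 0)"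
proof (induction as arbitrary: s)
  case Nil
  then show ?case
    using exec.While_False[of "Var (k + 1)" s "body k c"] by fastforce
next
  case (Cons a as)
  \<comment> \<open>Variable \<open>k + 1\<close> holds the rest of the list, \<open>k + 2\<close>
    the environment \<open>e\<close>, and 0 the accumulator; \<open>?x\<close> is what the body
    passes to the callee.\<close>
  let ?x = "Cell e (Cell a (s 0))"
  define s1 where "s1 = s(0 := ?x)"
  define s2 where "s2 = s1(k + 1 := list_data as)"
  define s3 where "s3 = s2(0 := F ?x)"
  have 1: "exec (Assign 0 (Mk_Cell (Var (k + 2)) (Mk_Cell (Left (Var (k + 1))) (Var 0)))) s 7 s1"
    by (rule exec_Assign) (use Cons.prems in \<open>auto simp: s1_def\<close>)
  have 2: "exec (Assign (k + 1) (Right (Var (k + 1)))) s1 3 s2"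
    by (rule exec_Assign) (use Cons.prems in \<open>auto simp: s1_def s2_def\<close>)
  have 3: "exec (call k c) s2 (T ?x + (2 * k + 1)) s3"
    unfolding s3_def using c vars by (rule exec_call) (auto simp: s2_def s1_def Cons.prems)
  have body: "exec (body k c) s (7 + (3 + (T ?x + (2 * k + 1)))) s3"
    unfolding body_def by (intro exec.Seq) (fact 1 2 3)+
  have s3_0: "s3 0 = f e a (s 0)"
    by (simp add: s3_def f_def)
  have "\<exists>t s'. exec (While (Var (k + 1)) (body k c)) s3 t s' \<and> t \<le> length as * (B + 2 * k + 13) + 2
          \<and> s' 0 = fold (f e) as (s3 0)"
  proof (rule Cons.IH)
    fix i assume "i < length as"
    then show "T (Cell e (Cell (as ! i) (fold (f e) (take i as) (s3 0)))) \<le> B"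
      using Cons.prems(4)[of "Suc i"] by (simp add: s3_0)
  qed (use Cons.prems in \<open>auto simp: s3_def s2_def s1_def\<close>)
  then obtain t s' where t: "exec (While (Var (k + 1)) (body k c)) s3 t s'"
      "t \<le> length as * (B + 2 * k + 13) + 2" "s' 0 = fold (f e) as (s3 0)"
    by blast
  \<comment> \<open>One round costs 2 for the guard, 7 and 3 for the assignments and
    \<open>2 * k + 1\<close> for clearing, hence \<open>2 * k + 13\<close> besides the call itself;
    the final 2 is the failing guard.\<close>
  have "exec (While (Var (k + 1)) (body k c)) s
      (cost_expr (Var (k + 1)) + 1 + (7 + (3 + (T ?x + (2 * k + 1)))) + t) s'"
    by (rule exec.While_True[OF _ body t(1)]) (use Cons.prems(1) in simp)
  moreover have "T ?x \<le> B"
    using Cons.prems(4)[of 0] by simp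
  ultimately show ?case
    using t s3_0 by (intro exI[of _ "13 + T ?x + 2 * k + t"] exI[of _ s']) (simp add: add_ac)
qed

text \<open>The list and the start value are computed from \<open>x\<close>, which is also the
  environment of every step. \<open>B\<close> has to bound only the steps that actually
  occur.\<close>

lemma computes_fold:
  fixes F :: "data \<Rightarrow> data" and T :: "data \<Rightarrow> nat"
  defines "f \<equiv> \<lambda>e a y. F (Cell e (Cell a y))"
  assumes c: "\<And>x. computes_in_time c x (F x) (T x)"
  shows "\<exists>d K. \<forall>x as y t1 t2 B. computes_in_time c1 x (list_data as) t1
     \<longrightarrow> computes_in_time c2 x y t2
     \<longrightarrow> (\<forall>i<length as. T (Cell x (Cell (as ! i) (fold (f x) (take i as) y))) \<le> B)
     \<longrightarrow> (\<exists>t \<le> t1 + t2 + length as * (B + K) + K. computes_in_time d x (fold (f x) as y) t)"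
proof -
  obtain k where k: "program_vars c1 \<subseteq> {..k}" "program_vars c2 \<subseteq> {..k}" "program_vars c \<subseteq> {..k}"
    by (rule program_vars_bound3)
  define loop where "loop = While (Var (k + 1))
      (Seq (Assign 0 (Mk_Cell (Var (k + 2)) (Mk_Cell (Left (Var (k + 1))) (Var 0))))
        (Seq (Assign (k + 1) (Right (Var (k + 1)))) (call k c)))"
  define d where "d = Seq (Assign (k + 2) (Var 0)) (Seq (call k c1) (Seq (Assign (k + 1) (Var 0))
      (Seq (Assign 0 (Var (k + 2))) (Seq (call k c2) loop))))"
  have "\<exists>t \<le> t1 + t2 + length as * (B + (4 * k + 13)) + (4 * k + 13).
      computes_in_time d x (fold (f x) as y) t"
    if c1: "computes_in_time c1 x (list_data as) t1" and c2: "computes_in_time c2 x y t2"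
      and B: "\<forall>i<length as. T (Cell x (Cell (as ! i) (fold (f x) (take i as) y))) \<le> B"
    for x as y t1 t2 B
  proof -
    define s1 where "s1 = (initial_store x)(k + 2 := x)"
    define s3 where "s3 = s1(0 := list_data as, k + 1 := list_data as, 0 := x)"
    have 1: "exec (Assign (k + 2) (Var 0)) (initial_store x) 2 s1"
      by (rule exec_Assign) (auto simp: s1_def initial_store_def)
    have 2: "exec (call k c1) s1 (t1 + (2 * k + 1)) (s1(0 := list_data as))"
      by (rule exec_call[OF c1 k(1)]) (auto simp: s1_def initial_store_def)
    have 3: "exec (Assign (k + 1) (Var 0)) (s1(0 := list_data as)) 2
        (s1(0 := list_data as, k + 1 := list_data as))"
      by (rule exec_Assign) auto
    have 4: "exec (Assign 0 (Var (k + 2))) (s1(0 := list_data as, k + 1 := list_data as)) 2 s3"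
      by (rule exec_Assign) (auto simp: s1_def s3_def)
    have 5: "exec (call k c2) s3 (t2 + (2 * k + 1)) (s3(0 := y))"
      by (rule exec_call[OF c2 k(2)]) (auto simp: s1_def s3_def initial_store_def)
    have "\<exists>t s'. exec loop (s3(0 := y)) t s' \<and> t \<le> length as * (B + 2 * k + 13) + 2
        \<and> s' 0 = fold (f x) as ((s3(0 := y)) 0)"
      unfolding loop_def f_def
      by (rule exec_fold[OF c k(3)]) (use B in \<open>auto simp: s1_def s3_def initial_store_def f_def\<close>)
    then obtain t s' where 6: "exec loop (s3(0 := y)) t s'"
        and t: "t \<le> length as * (B + 2 * k + 13) + 2" "s' 0 = fold (f x) as y"
      by auto
    have "exec d (initial_store x)
        (2 + (t1 + (2 * k + 1) + (2 + (2 + (t2 + (2 * k + 1) + t))))) s'"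
      unfolding d_def by (intro exec.Seq) (fact 1 2 3 4 5 6)+
    moreover have "length as * (B + 2 * k + 13) \<le> length as * (B + (4 * k + 13))"
      by (rule mult_left_mono) auto
    then have "2 + (t1 + (2 * k + 1) + (2 + (2 + (t2 + (2 * k + 1) + t))))
        \<le> t1 + t2 + length as * (B + (4 * k + 13)) + (4 * k + 13)"
      using t(1) by linarith
    ultimately show ?thesis
      unfolding computes_in_time_def using t(2) by blast
  qed
  then show ?thesis
    by blast
qed


section \<open>Polynomial-time functions\<close>

text \<open>The size of the result is bounded separately, because sharing allows a program to build
  trees of exponential size.\<close>

definition poly_time :: "(data \<Rightarrow> data) \<Rightarrow> bool" where
  "poly_time f \<longleftrightarrow> (\<exists>c T. (\<forall>x. computes_in_time c x (f x) (T x)) \<and>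
     poly_bounded UNIV size T \<and> poly_bounded UNIV size (\<lambda>x. size (f x)))"

definition poly_time_pred :: "(data \<Rightarrow> bool) \<Rightarrow> bool" where
  "poly_time_pred P \<longleftrightarrow> poly_time (\<lambda>x. bit_data (P x))"

text \<open>\<open>computes_in_time\<close> fixes exact times, whereas branches and loops yield
  upper bounds; the exact time is chosen afterwards.\<close>

lemma poly_timeI:
  assumes "\<And>x. \<exists>t \<le> T x. computes_in_time c x (f x) t"
    and "poly_bounded UNIV size T" "poly_bounded UNIV size (\<lambda>x. size (f x))"
  shows "poly_time f"
proof -
  obtain T' where "\<And>x. T' x \<le> T x" "\<And>x. computes_in_time c x (f x) (T' x)"
    using assms(1) by metis
  then show ?thesis
    using assms(2,3) poly_bounded_mono[OF assms(2)] unfolding poly_time_def by blast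
qed

lemma poly_timeE:
  assumes "poly_time f"
  obtains c T where "\<And>x. computes_in_time c x (f x) (T x)"
    and "poly_bounded UNIV size T" "poly_bounded UNIV size (\<lambda>x. size (f x))"
  using assms unfolding poly_time_def by blast

lemma poly_time_size: "poly_time f \<Longrightarrow> poly_bounded UNIV size (\<lambda>x. size (f x))"
  unfolding poly_time_def by blast

lemma poly_time_expr:
  assumes "poly_bounded UNIV size (\<lambda>x. size (eval_expr e (initial_store x)))"
  shows "poly_time (\<lambda>x. eval_expr e (initial_store x))"
proof (rule poly_timeI[OF _ poly_bounded_const assms])
  show "\<exists>t \<le> cost_expr e + 1. computes_in_time (Assign 0 e) x (eval_expr e (initial_store x)) t" for x
    unfolding computes_in_time_def using exec.Assign by (metis fun_upd_same order_refl)
qed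

lemma poly_time_comp:
  assumes "poly_time f" "poly_time g"
  shows "poly_time (\<lambda>x. f (g x))"
proof -
  obtain c T where f: "\<And>x. computes_in_time c x (f x) (T x)" "poly_bounded UNIV size T"
      "poly_bounded UNIV size (\<lambda>x. size (f x))"
    using assms(1) by (rule poly_timeE) blast
  obtain d S where g: "\<And>x. computes_in_time d x (g x) (S x)" "poly_bounded UNIV size S"
      "poly_bounded UNIV size (\<lambda>x. size (g x))"
    using assms(2) by (rule poly_timeE) blast
  obtain p K where p: "\<And>x y z t1 t2. computes_in_time d x y t1 \<Longrightarrow> computes_in_time c y z t2
     \<Longrightarrow> computes_in_time p x z (t1 + t2 + K)"
    using computes_seq[of d c] by blast
  show ?thesis
  proof (rule poly_timeI)
    show "\<exists>t \<le> S x + T (g x) + K. computes_in_time p x (f (g x)) t" for x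
      using p f g by blast
    show "poly_bounded UNIV size (\<lambda>x. S x + T (g x) + K)"
      by (intro poly_bounded_intros poly_bounded_comp[OF f(2)] g)
    show "poly_bounded UNIV size (\<lambda>x. size (f (g x)))"
      by (intro poly_bounded_comp[OF f(3)] g)
  qed
qed

lemma poly_time_id: "poly_time (\<lambda>x. x)"
  using poly_time_expr[of "Var 0"] by (simp add: initial_store_def poly_bounded_measure)

lemma poly_time_const: "poly_time (\<lambda>_. d)"
proof -
  have "\<exists>e. \<forall>s. eval_expr e s = d"
  proof (induction d)
    case Atom
    show ?case
      by (rule exI[of _ Const_Atom]) simp
  next
    case (Cell a b)
    then show ?case
      by (metis eval_expr.simps(3))
  qed
  then obtain e where "\<And>s. eval_expr e s = d"
    by blast
  then show ?thesis
    using poly_time_expr[of e] by (simp add: poly_bounded_const)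
qed

lemma size_left_le: "size (left d) \<le> size d"
  by (cases d) auto

lemma size_right_le: "size (right d) \<le> size d"
  by (cases d) auto

lemma poly_time_left: "poly_time g \<Longrightarrow> poly_time (\<lambda>x. left (g x))"
proof (erule poly_time_comp[rotated])
  show "poly_time left"
    using poly_time_expr[of "Left (Var 0)"] poly_bounded_mono[OF poly_bounded_measure, of UNIV "\<lambda>x. size (left x)" size]
    by (simp add: initial_store_def size_left_le)
qed

lemma poly_time_right: "poly_time g \<Longrightarrow> poly_time (\<lambda>x. right (g x))"
proof (erule poly_time_comp[rotated])
  show "poly_time right"
    using poly_time_expr[of "Right (Var 0)"] poly_bounded_mono[OF poly_bounded_measure, of UNIV "\<lambda>x. size (right x)" size]
    by (simp add: initial_store_def size_right_le)
qed

lemma poly_time_Cell: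
  assumes "poly_time f" "poly_time g"
  shows "poly_time (\<lambda>x. Cell (f x) (g x))"
proof -
  obtain c T where f: "\<And>x. computes_in_time c x (f x) (T x)" "poly_bounded UNIV size T"
      "poly_bounded UNIV size (\<lambda>x. size (f x))"
    using assms(1) by (rule poly_timeE) blast
  obtain d S where g: "\<And>x. computes_in_time d x (g x) (S x)" "poly_bounded UNIV size S"
      "poly_bounded UNIV size (\<lambda>x. size (g x))"
    using assms(2) by (rule poly_timeE) blast
  obtain p K where p: "\<And>x y z t1 t2. computes_in_time c x y t1 \<Longrightarrow> computes_in_time d x z t2
     \<Longrightarrow> computes_in_time p x (Cell y z) (t1 + t2 + K)"
    using computes_pair[of c d] by blast
  show ?thesis
  proof (rule poly_timeI)
    show "\<exists>t \<le> T x + S x + K. computes_in_time p x (Cell (f x) (g x)) t" for x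
      using p f g by blast
    show "poly_bounded UNIV size (\<lambda>x. T x + S x + K)"
      by (intro poly_bounded_intros f g)
    have "poly_bounded UNIV size (\<lambda>x. size (f x) + size (g x) + 1)"
      by (intro poly_bounded_intros f g)
    then show "poly_bounded UNIV size (\<lambda>x. size (Cell (f x) (g x)))"
      by simp
  qed
qed

lemma poly_time_cond:
  assumes "poly_time b" "poly_time f" "poly_time g"
  shows "poly_time (\<lambda>x. if b x \<noteq> Atom then f x else g x)"
proof -
  obtain a R where b: "\<And>x. computes_in_time a x (b x) (R x)" "poly_bounded UNIV size R"
    using assms(1) by (rule poly_timeE) blast
  obtain c T where f: "\<And>x. computes_in_time c x (f x) (T x)" "poly_bounded UNIV size T"
      "poly_bounded UNIV size (\<lambda>x. size (f x))"
    using assms(2) by (rule poly_timeE) blast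
  obtain d S where g: "\<And>x. computes_in_time d x (g x) (S x)" "poly_bounded UNIV size S"
      "poly_bounded UNIV size (\<lambda>x. size (g x))"
    using assms(3) by (rule poly_timeE) blast
  obtain p K where p: "\<And>x y z t1 t2. computes_in_time a x y t1
     \<Longrightarrow> computes_in_time (if y \<noteq> Atom then c else d) x z t2
     \<Longrightarrow> computes_in_time p x z (t1 + t2 + K)"
    using computes_cond[of a c d] by blast
  show ?thesis
  proof (rule poly_timeI)
    show "\<exists>t \<le> R x + (T x + S x) + K. computes_in_time p x (if b x \<noteq> Atom then f x else g x) t" for x
    proof (intro exI conjI)
      show "computes_in_time p x (if b x \<noteq> Atom then f x else g x)
          (R x + (if b x \<noteq> Atom then T x else S x) + K)"
        by (rule p[OF b(1)]) (simp add: f g)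
    qed simp
    show "poly_bounded UNIV size (\<lambda>x. R x + (T x + S x) + K)"
      by (intro poly_bounded_intros b f g)
    show "poly_bounded UNIV size (\<lambda>x. size (if b x \<noteq> Atom then f x else g x))"
      by (rule poly_bounded_mono[OF poly_bounded_add[OF f(3) g(3)]]) simp
  qed
qed

lemma bit_data_eq_Atom [simp]: "bit_data b = Atom \<longleftrightarrow> \<not> b"
  by (simp add: bit_data_def)

lemma poly_time_if:
  assumes "poly_time_pred P" "poly_time f" "poly_time g"
  shows "poly_time (\<lambda>x. if P x then f x else g x)"
  using poly_time_cond[OF assms[unfolded poly_time_pred_def]] by simp

lemma poly_time_bit: "poly_time_pred P \<Longrightarrow> poly_time (\<lambda>x. bit_data (P x))"
  by (simp add: poly_time_pred_def)

lemma poly_time_pred_nonatom: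
  assumes "poly_time f"
  shows "poly_time_pred (\<lambda>x. f x \<noteq> Atom)"
proof -
  have "bit_data (f x \<noteq> Atom) = (if f x \<noteq> Atom then bit_data True else bit_data False)" for x
    by simp
  then show ?thesis
    using poly_time_cond[OF assms poly_time_const poly_time_const]
    unfolding poly_time_pred_def by presburger
qed

lemma poly_time_pred_not:
  assumes "poly_time_pred P"
  shows "poly_time_pred (\<lambda>x. \<not> P x)"
proof -
  have "bit_data (\<not> P x) = (if P x then bit_data False else bit_data True)" for x
    by simp
  then show ?thesis
    using poly_time_if[OF assms poly_time_const poly_time_const]
    unfolding poly_time_pred_def by presburger
qed

lemma poly_time_pred_conj:
  assumes "poly_time_pred P" "poly_time_pred Q"
  shows "poly_time_pred (\<lambda>x. P x \<and> Q x)"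
proof -
  have "bit_data (P x \<and> Q x) = (if P x then bit_data (Q x) else bit_data False)" for x
    by simp
  then show ?thesis
    using poly_time_if[OF assms(1) poly_time_bit[OF assms(2)] poly_time_const]
    unfolding poly_time_pred_def by presburger
qed

lemma poly_time_pred_disj:
  assumes "poly_time_pred P" "poly_time_pred Q"
  shows "poly_time_pred (\<lambda>x. P x \<or> Q x)"
  using poly_time_pred_not[OF poly_time_pred_conj[OF assms[THEN poly_time_pred_not]]] by simp

section \<open>Folds and list operations in polynomial time\<close>

lemma length_data_list_le: "length (data_list d) \<le> size d"
  by (induction d) auto

lemma size_nth_data_list_le: "i < length (data_list d) \<Longrightarrow> size (data_list d ! i) \<le> size d"
proof (induction d arbitrary: i)
  case (Cell a b)
  then show ?case
    by (cases i) (auto intro: le_SucI trans_le_add2)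
qed simp

text \<open>The bound \<open>S\<close> on all intermediate accumulators does not follow from
  \<open>f\<close> being polynomial: iterating \<open>Cell y y\<close> doubles the size in every
  step.\<close>

lemma poly_time_fold:
  assumes f: "poly_time (\<lambda>z. f (left z) (left (right z)) (right (right z)))"
    and g: "poly_time g" and h: "poly_time h"
    and S: "poly_bounded UNIV size S"
      "\<And>x i. i \<le> length (data_list (g x))
        \<Longrightarrow> size (fold (f x) (take i (data_list (g x))) (h x)) \<le> S x"
  shows "poly_time (\<lambda>x. fold (f x) (data_list (g x)) (h x))"
proof -
  let ?F = "\<lambda>z. f (left z) (left (right z)) (right (right z))"
  obtain c T where c: "\<And>x. computes_in_time c x (?F x) (T x)" "poly_bounded UNIV size T"
    using f by (rule poly_timeE) blast
  obtain c1 T1 where g': "\<And>x. computes_in_time c1 x (g x) (T1 x)" "poly_bounded UNIV size T1"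
      "poly_bounded UNIV size (\<lambda>x. size (g x))"
    using g by (rule poly_timeE) blast
  obtain c2 T2 where h': "\<And>x. computes_in_time c2 x (h x) (T2 x)" "poly_bounded UNIV size T2"
    using h by (rule poly_timeE) blast
  obtain d K where d: "\<And>x as y t1 t2 B. computes_in_time c1 x (list_data as) t1
     \<Longrightarrow> computes_in_time c2 x y t2
     \<Longrightarrow> (\<forall>i<length as. T (Cell x (Cell (as ! i) (fold (f x) (take i as) y))) \<le> B)
     \<Longrightarrow> \<exists>t \<le> t1 + t2 + length as * (B + K) + K. computes_in_time d x (fold (f x) as y) t"
    using computes_fold[OF c(1), of c1 c2] by simp metis
  obtain k where k: "\<And>z. T z \<le> (size z + 2) ^ k"
    using c(2) unfolding poly_bounded_def by blast
  define B where "B x = (size x + size (g x) + S x + 4) ^ k" for x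
  show ?thesis
  proof (rule poly_timeI)
    fix x
    have "T (Cell x (Cell (data_list (g x) ! i) (fold (f x) (take i (data_list (g x))) (h x)))) \<le> B x"
      if i: "i < length (data_list (g x))" for i
    proof -
      let ?z = "Cell x (Cell (data_list (g x) ! i) (fold (f x) (take i (data_list (g x))) (h x)))"
      have "size ?z + 2 \<le> size x + size (g x) + S x + 4"
        using size_nth_data_list_le[OF i] S(2)[of i x] i by simp
      then have "(size ?z + 2) ^ k \<le> B x"
        unfolding B_def by (rule power_mono) simp
      then show ?thesis
        using k le_trans by blast
    qed
    then obtain t where "t \<le> T1 x + T2 x + length (data_list (g x)) * (B x + K) + K"
        "computes_in_time d x (fold (f x) (data_list (g x)) (h x)) t"
      using d[of x "data_list (g x)" "T1 x" "h x" "T2 x" "B x"] g'(1) h'(1) by auto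
    moreover have "length (data_list (g x)) * (B x + K) \<le> size (g x) * (B x + K)"
      using length_data_list_le by (rule mult_right_mono) simp
    ultimately show "\<exists>t \<le> T1 x + T2 x + size (g x) * (B x + K) + K.
        computes_in_time d x (fold (f x) (data_list (g x)) (h x)) t"
      by (meson add_le_mono1 add_left_mono le_trans)
  next
    show "poly_bounded UNIV size (\<lambda>x. T1 x + T2 x + size (g x) * (B x + K) + K)"
      unfolding B_def by (intro poly_bounded_intros poly_bounded_power g' h' S)
    show "poly_bounded UNIV size (\<lambda>x. size (fold (f x) (data_list (g x)) (h x)))"
      using S(2)[OF order_refl] by (intro poly_bounded_mono[OF S(1)]) simp
  qed
qed

text \<open>Programs have a single input, so a binary function is treated as a function on pairs.
  The rules for \<open>map\<close>, \<open>filter\<close> and \<open>concat\<close> use the same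
  convention for a body with environment.\<close>

lemma poly_time_binary_comp:
  assumes "poly_time (\<lambda>z. f (left z) (right z))" "poly_time g" "poly_time h"
  shows "poly_time (\<lambda>x. f (g x) (h x))"
  using poly_time_comp[OF assms(1) poly_time_Cell[OF assms(2,3)]] by simp

lemma size_list_data_le:
  assumes "\<And>a. a \<in> set as \<Longrightarrow> size a \<le> B"
  shows "size (list_data as) \<le> length as * (B + 1)"
  using assms
proof (induction as)
  case (Cons a as)
  then have "size a \<le> B" "size (list_data as) \<le> length as * (B + 1)"
    by simp_all
  then show ?case
    by simp
qed simp

lemma size_mem_data_list: "a \<in> set (data_list d) \<Longrightarrow> size a \<le> size d"
  by (metis in_set_conv_nth size_nth_data_list_le)

text \<open>Entries of \<open>g x\<close> are no larger than \<open>g x\<close>, which makes the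
  bound uniform over the list; it feeds the accumulator bounds of
  \<open>poly_time_fold\<close>.\<close>

lemma map_size_bound:
  assumes f: "poly_time (\<lambda>z. f (left z) (right z))" and g: "poly_time g"
  obtains S where "poly_bounded UNIV size S"
    "\<And>x a. a \<in> set (data_list (g x)) \<Longrightarrow> size (f x a) \<le> S x"
proof -
  obtain k where k: "\<And>z. size (f (left z) (right z)) \<le> (size z + 2) ^ k"
    using poly_time_size[OF f] unfolding poly_bounded_def by blast
  show thesis
  proof
    show "poly_bounded UNIV size (\<lambda>x. (size x + size (g x) + 3) ^ k)"
      by (intro poly_bounded_intros poly_bounded_power poly_time_size g)
    show "size (f x a) \<le> (size x + size (g x) + 3) ^ k" if "a \<in> set (data_list (g x))" for x a
    proof -
      have "size (f x a) \<le> (size (Cell x a) + 2) ^ k"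
        using k[of "Cell x a"] by simp
      also have "\<dots> \<le> (size x + size (g x) + 3) ^ k"
        using size_mem_data_list[OF that] by (intro power_mono) simp_all
      finally show ?thesis .
    qed
  qed
qed

text \<open>Consing onto the accumulator reverses the list; a second reversal then gives
  \<open>map\<close>.\<close>

lemma poly_time_rev_map:
  assumes f: "poly_time (\<lambda>z. f (left z) (right z))" and g: "poly_time g"
  shows "poly_time (\<lambda>x. list_data (rev (map (f x) (data_list (g x)))))"
proof -
  obtain S where S: "poly_bounded UNIV size S"
      "\<And>x a. a \<in> set (data_list (g x)) \<Longrightarrow> size (f x a) \<le> S x"
    using map_size_bound[OF f g] by blast
  have fold: "fold (\<lambda>a. Cell (f x a)) as Atom = list_data (rev (map (f x) as))" for x as
    by (induction as rule: rev_induct) auto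
  have "poly_time (\<lambda>x. fold (\<lambda>a. Cell (f x a)) (data_list (g x)) Atom)"
  proof (rule poly_time_fold[where f = "\<lambda>x a. Cell (f x a)"])
    show "poly_time (\<lambda>z. Cell (f (left z) (left (right z))) (right (right z)))"
      by (intro poly_time_Cell poly_time_binary_comp[OF f] poly_time_left poly_time_right poly_time_id)
    show "poly_bounded UNIV size (\<lambda>x. size (g x) * (S x + 1))"
      by (intro poly_bounded_intros S poly_time_size g)
    show "size (fold (\<lambda>a. Cell (f x a)) (take i (data_list (g x))) Atom) \<le> size (g x) * (S x + 1)"
      if "i \<le> length (data_list (g x))" for x i
    proof -
      have "size (list_data (rev (map (f x) (take i (data_list (g x)))))) \<le> i * (S x + 1)"
        using size_list_data_le[of "rev (map (f x) (take i (data_list (g x))))" "S x"]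
          S(2)[of _ x] that by (auto dest: in_set_takeD)
      also have "\<dots> \<le> size (g x) * (S x + 1)"
        using that length_data_list_le le_trans by (blast intro: mult_right_mono)
      finally show ?thesis
        by (simp only: fold)
    qed
  qed (fact g poly_time_const)+
  then show ?thesis
    by (simp only: fold)
qed

lemma poly_time_rev:
  assumes "poly_time g"
  shows "poly_time (\<lambda>x. list_data (rev (data_list (g x))))"
  using poly_time_rev_map[of "\<lambda>_ a. a", OF poly_time_right[OF poly_time_id] assms] by simp

lemma poly_time_map:
  assumes "poly_time (\<lambda>z. f (left z) (right z))" "poly_time (\<lambda>x. list_data (g x))"
  shows "poly_time (\<lambda>x. list_data (map (f x) (g x)))"
  using poly_time_rev[OF poly_time_rev_map[OF assms]] by simp

lemma poly_time_append:
  assumes f: "poly_time (\<lambda>x. list_data (f x))" and g: "poly_time (\<lambda>x. list_data (g x))"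
  shows "poly_time (\<lambda>x. list_data (f x @ g x))"
proof -
  have fold: "fold Cell as (list_data bs) = list_data (rev as @ bs)" for as bs
    by (induction as arbitrary: bs rule: rev_induct) auto
  have "poly_time (\<lambda>x. fold Cell (data_list (list_data (rev (f x)))) (list_data (g x)))"
  proof (rule poly_time_fold[where f = "\<lambda>_. Cell"])
    show "poly_time (\<lambda>z. Cell (left (right z)) (right (right z)))"
      by (intro poly_time_Cell poly_time_left poly_time_right poly_time_id)
    show "poly_time (\<lambda>x. list_data (rev (f x)))"
      using poly_time_rev[OF f] by simp
    show "poly_bounded UNIV size (\<lambda>x. size (list_data (f x)) + size (list_data (g x)))"
      by (intro poly_bounded_intros poly_time_size f g)
    show "size (fold Cell (take i (data_list (list_data (rev (f x))))) (list_data (g x)))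
        \<le> size (list_data (f x)) + size (list_data (g x))" for x i
    proof -
      \<comment> \<open>After \<open>i\<close> steps the accumulator is a suffix of
        \<open>f x\<close> in front of \<open>g x\<close>, so it never exceeds the final
        size.\<close>
      have "sum_list (map (\<lambda>a. size a + 1) (rev (f x)))
          = sum_list (map (\<lambda>a. size a + 1) (take i (rev (f x))))
            + sum_list (map (\<lambda>a. size a + 1) (drop i (rev (f x))))"
        by (metis append_take_drop_id map_append sum_list_append)
      moreover have "sum_list (map (\<lambda>a. size a + 1) (rev (f x)))
          = sum_list (map (\<lambda>a. size a + 1) (f x))"
        by (simp only: rev_map[symmetric] sum_list_rev)
      moreover have "sum_list (map (\<lambda>a. size a + 1) (rev (take i (rev (f x)))))
          = sum_list (map (\<lambda>a. size a + 1) (take i (rev (f x))))"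
        by (simp only: rev_map[symmetric] sum_list_rev)
      ultimately show ?thesis
        by (simp only: fold size_list_data map_append sum_list_append data_list_list_data)
    qed
  qed (fact g)
  then show ?thesis
    by (simp add: fold)
qed

lemma poly_time_concat_map:
  assumes f: "poly_time (\<lambda>z. list_data (f (left z) (right z)))"
    and g: "poly_time (\<lambda>x. list_data (g x))"
  shows "poly_time (\<lambda>x. list_data (concat (map (f x) (g x))))"
proof -
  obtain S where S: "poly_bounded UNIV size S"
      "\<And>x a. a \<in> set (g x) \<Longrightarrow> size (list_data (f x a)) \<le> S x"
    using map_size_bound[OF f g] by auto
  have fold: "fold (\<lambda>a s. list_data (data_list s @ f x a)) as Atom = list_data (concat (map (f x) as))"
    for x as
    by (induction as rule: rev_induct) auto
  have size: "size (list_data (concat (map (f x) as))) \<le> length as * S x"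
    if "set as \<subseteq> set (g x)" for x as
    using that
  proof (induction as)
    case (Cons a as)
    have "size (list_data (f x a @ concat (map (f x) as)))
        = size (list_data (f x a)) + size (list_data (concat (map (f x) as)))"
      by (simp add: size_list_data)
    then show ?case
      using Cons S(2)[of a x] by simp
  qed simp
  have "poly_time (\<lambda>x. fold (\<lambda>a s. list_data (data_list s @ f x a)) (data_list (list_data (g x))) Atom)"
  proof (rule poly_time_fold[where f = "\<lambda>x a s. list_data (data_list s @ f x a)"])
    show "poly_time (\<lambda>z. list_data (data_list (right (right z)) @ f (left z) (left (right z))))"
      by (intro poly_time_append poly_time_binary_comp[of "\<lambda>x a. list_data (f x a)", OF f])
        (simp_all add: poly_time_left poly_time_right poly_time_id)
    show "poly_bounded UNIV size (\<lambda>x. size (list_data (g x)) * S x)"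
      by (intro poly_bounded_intros S poly_time_size g)
    show "size (fold (\<lambda>a s. list_data (data_list s @ f x a)) (take i (data_list (list_data (g x)))) Atom)
        \<le> size (list_data (g x)) * S x" if "i \<le> length (data_list (list_data (g x)))" for x i
    proof -
      have "size (list_data (concat (map (f x) (take i (g x))))) \<le> i * S x"
        using size[of "take i (g x)" x] that by (auto dest: in_set_takeD)
      also have "\<dots> \<le> size (list_data (g x)) * S x"
        using that length_data_list_le le_trans by (blast intro: mult_right_mono)
      finally show ?thesis
        by (simp add: fold)
    qed
  qed (fact g poly_time_const)+
  then show ?thesis
    by (simp add: fold)
qed

text \<open>Filtering is concatenation of lists with at most one entry. These are written as
  \<open>data_list\<close> of a conditional on trees so that \<open>poly_time_if\<close>
  applies.\<close>

lemma poly_time_filter: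
  assumes P: "poly_time_pred (\<lambda>z. P (left z) (right z))" and g: "poly_time (\<lambda>x. list_data (g x))"
  shows "poly_time (\<lambda>x. list_data (filter (P x) (g x)))"
proof -
  have "poly_time (\<lambda>x. list_data (concat (map (\<lambda>a. data_list (if P x a then Cell a Atom else Atom)) (g x))))"
    by (rule poly_time_concat_map[where f = "\<lambda>x a. data_list (if P x a then Cell a Atom else Atom)", OF _ g])
      (unfold list_data_data_list,
        intro poly_time_if P poly_time_Cell poly_time_const poly_time_right poly_time_id)
  moreover have "concat (map (\<lambda>a. data_list (if P x a then Cell a Atom else Atom)) as) = filter (P x) as" for x as
    by (induction as) auto
  ultimately show ?thesis
    by simp
qed

text \<open>Only the length of \<open>f x\<close> matters: a list serves as a unary loop
  counter.\<close>

lemma poly_time_drop: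
  assumes f: "poly_time (\<lambda>x. list_data (f x))" and g: "poly_time g"
  shows "poly_time (\<lambda>x. (right ^^ length (f x)) (g x))"
proof -
  have fold: "fold (\<lambda>_. right) as d = (right ^^ length as) d" for as :: "data list" and d
    by (induction as arbitrary: d) (simp_all add: funpow_swap1)
  have size: "size ((right ^^ i) d) \<le> size d" for i d
    by (induction i) (auto intro: le_trans[OF size_right_le])
  have "poly_time (\<lambda>x. fold (\<lambda>_. right) (data_list (list_data (f x))) (g x))"
  proof (rule poly_time_fold[where f = "\<lambda>_ _. right"])
    show "poly_time (\<lambda>z. right (right (right z)))"
      by (intro poly_time_right poly_time_id)
    show "poly_bounded UNIV size (\<lambda>x. size (g x))"
      by (intro poly_time_size g)
  qed (simp_all add: f g fold size)
  then show ?thesis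
    by (simp add: fold)
qed

section \<open>Unary numbers, indexing and comparison\<close>

definition nth_data :: "data \<Rightarrow> nat \<Rightarrow> data" where
  "nth_data d i = left ((right ^^ i) d)"

text \<open>Unary notation reduces arithmetic to list operations. It is affordable because the
  numbers are tags and indices of the order of the number of rows of an adjacency matrix.\<close>

definition nat_data :: "nat \<Rightarrow> data" where
  "nat_data n = list_data (replicate n Atom)"

text \<open>Every tree counts as a number, the length of its right spine; in particular a graph
  encoding doubles as its number of vertices.\<close>

definition data_nat :: "data \<Rightarrow> nat" where
  "data_nat d = length (data_list d)"

lemma data_nat_nat_data [simp]: "data_nat (nat_data n) = n"
  by (simp add: data_nat_def nat_data_def)

lemma nat_data_0: "nat_data 0 = Atom"
  by (simp add: nat_data_def)

lemma nat_data_Suc: "nat_data (Suc n) = Cell Atom (nat_data n)"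
  by (simp add: nat_data_def)

lemma drop_data: "(right ^^ i) d = list_data (drop i (data_list d))"
proof (induction i)
  case (Suc i)
  have "right (list_data as) = list_data (tl as)" for as
    by (cases as) simp_all
  with Suc show ?case
    by (simp add: drop_Suc tl_drop)
qed simp

text \<open>Past the end \<open>left\<close> and \<open>right\<close> stay at \<open>Atom\<close>,
  so an index out of range reads as a zero bit.\<close>

lemma nth_data_list_data:
  "nth_data (list_data as) i = (if i < length as then as ! i else Atom)"
  by (auto simp: nth_data_def drop_data Cons_nth_drop_Suc[symmetric])

lemma poly_time_nth_data:
  assumes "poly_time f" "poly_time g"
  shows "poly_time (\<lambda>x. nth_data (f x) (data_nat (g x)))"
  using poly_time_left[OF poly_time_drop[of "\<lambda>x. data_list (g x)" f]] assms
  by (simp add: nth_data_def data_nat_def)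

text \<open>Comparison by truncated subtraction: nothing is left of \<open>f x\<close> once as many
  entries as \<open>g x\<close> has are dropped.\<close>

lemma poly_time_pred_le:
  assumes "poly_time f" "poly_time g"
  shows "poly_time_pred (\<lambda>x. data_nat (f x) \<le> data_nat (g x))"
proof -
  have "(right ^^ length as) (list_data bs) = Atom \<longleftrightarrow> length bs \<le> length as" for as bs :: "data list"
    using list_data_inject[of "drop (length as) bs" "[]"] by (simp add: drop_data del: list_data_inject)
  then have *: "\<not> (right ^^ length (data_list (g x))) (f x) \<noteq> Atom \<longleftrightarrow> data_nat (f x) \<le> data_nat (g x)" for x
    using list_data_data_list[of "f x"] unfolding data_nat_def by metis
  have "poly_time_pred (\<lambda>x. \<not> (right ^^ length (data_list (g x))) (f x) \<noteq> Atom)"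
    using assms by (intro poly_time_pred_not poly_time_pred_nonatom poly_time_drop) simp_all
  then show ?thesis
    by (simp only: *)
qed

lemma poly_time_pred_eq:
  assumes "poly_time f" "poly_time g"
  shows "poly_time_pred (\<lambda>x. data_nat (f x) = data_nat (g x))"
  using poly_time_pred_conj[OF poly_time_pred_le[OF assms] poly_time_pred_le[OF assms(2,1)]]
  by (simp add: order_eq_iff)

lemma poly_time_pred_eq_const:
  assumes "poly_time f"
  shows "poly_time_pred (\<lambda>x. data_nat (f x) = n)"
  using poly_time_pred_eq[OF assms poly_time_const[of "nat_data n"]] by simp

text \<open>Each round puts 0 in front of the successors of the numbers so far, a successor being
  one more \<open>Cell Atom\<close>; the accumulator has at most quadratic size.\<close>

lemma poly_time_upt:
  assumes g: "poly_time g"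
  shows "poly_time (\<lambda>x. list_data (map nat_data [0..<data_nat (g x)]))"
proof -
  have fold: "fold (\<lambda>_ s. Cell Atom (list_data (map (Cell Atom) (data_list s)))) as Atom
      = list_data (map nat_data [0..<length as])" for as :: "data list"
  proof (induction as rule: rev_induct)
    case (snoc a as)
    have "map nat_data [0..<Suc m] = Atom # map (Cell Atom) (map nat_data [0..<m])" for m
      by (simp add: upt_conv_Cons map_Suc_upt[symmetric] nat_data_0 nat_data_Suc comp_def del: upt_Suc)
    with snoc show ?case
      by simp
  qed simp
  have size_nat: "size (nat_data n) = n" for n
    by (simp add: nat_data_def size_list_data sum_list_replicate)
  have "poly_time (\<lambda>x. fold (\<lambda>_ s. Cell Atom (list_data (map (Cell Atom) (data_list s)))) (data_list (g x)) Atom)"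
  proof (rule poly_time_fold[where f = "\<lambda>_ _ s. Cell Atom (list_data (map (Cell Atom) (data_list s)))"])
    show "poly_time (\<lambda>z. Cell Atom (list_data (map (Cell Atom) (data_list (right (right z))))))"
      by (intro poly_time_Cell poly_time_map poly_time_const)
        (simp_all add: poly_time_right poly_time_id)
    show "poly_bounded UNIV size (\<lambda>x. size (g x) * (size (g x) + 1))"
      by (intro poly_bounded_intros poly_time_size g)
    show "size (fold (\<lambda>_ s. Cell Atom (list_data (map (Cell Atom) (data_list s)))) (take i (data_list (g x))) Atom)
       \<le> size (g x) * (size (g x) + 1)" if "i \<le> length (data_list (g x))" for x i
    proof -
      have i: "i \<le> size (g x)"
        using that length_data_list_le le_trans by blast
      have "size (list_data (map nat_data [0..<i])) \<le> i * (size (g x) + 1)"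
      proof -
        have "size a \<le> size (g x)" if "a \<in> set (map nat_data [0..<i])" for a
          using that i by (auto simp: size_nat)
        then have "size (list_data (map nat_data [0..<i]))
            \<le> length (map nat_data [0..<i]) * (size (g x) + 1)"
          by (rule size_list_data_le)
        then show ?thesis
          by simp
      qed
      also have "\<dots> \<le> size (g x) * (size (g x) + 1)"
        using i by (rule mult_right_mono) simp
      finally show ?thesis
        using that by (simp add: fold min_def)
    qed
  qed (fact g poly_time_const)+
  then show ?thesis
    by (simp add: fold data_nat_def)
qed

text \<open>With these closure rules polynomial time is read off the defining expression, which is
  why the encoded reduction is composed of list operations only.\<close>

lemmas poly_time_intros =
  poly_time_id poly_time_const poly_time_left poly_time_right poly_time_Cell poly_time_bit
  poly_time_map poly_time_append poly_time_concat_map poly_time_filter poly_time_nth_data poly_time_upt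
  poly_time_pred_nonatom poly_time_pred_not poly_time_pred_conj poly_time_pred_disj
  poly_time_pred_eq poly_time_pred_eq_const


section \<open>The reduction graph\<close>

text \<open>A vertex of degree at most one is an alliance on its own, so that the leaves (attached or
  isolated) occur in no other minimal alliance; they only raise the demand of their neighbours.\<close>

datatype core = Element nat | Constraint nat | Forced nat | Hub

datatype vertex = Core core | Leaf core nat

definition closed_adj :: "nat pair_pre_digraph \<Rightarrow> nat \<Rightarrow> nat \<Rightarrow> bool" where
  "closed_adj G v w \<longleftrightarrow> v = w \<or> (v, w) \<in> parcs G"

text \<open>Edges are listed in one direction, from the side of the constraints and the hub;
  \<open>reduction_graph\<close> adds the reverse.\<close>

fun core_edge :: "nat pair_pre_digraph \<Rightarrow> core \<Rightarrow> core \<Rightarrow> bool" where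
  "core_edge G (Constraint v) (Element w) \<longleftrightarrow> closed_adj G v w"
| "core_edge G (Constraint v) (Forced i) \<longleftrightarrow> True"
| "core_edge G Hub (Forced i) \<longleftrightarrow> True"
| "core_edge G _ _ \<longleftrightarrow> False"

text \<open>A vertex of degree \<open>d\<close> needs \<open>\<lfloor>d / 2\<rfloor>\<close> neighbours in the alliance.  With the leaves below the
  constraints, the forced vertices and the hub have degrees \<open>2 n + 2\<close>, \<open>2 n + 3\<close> and \<open>2 n + 1\<close>.\<close>

fun has_leaf :: "nat pair_pre_digraph \<Rightarrow> core \<Rightarrow> nat \<Rightarrow> bool" where
  "has_leaf G (Element i) j \<longleftrightarrow> j = 0"
| "has_leaf G (Constraint v) j \<longleftrightarrow> \<not> closed_adj G v j"
| "has_leaf G (Forced i) j \<longleftrightarrow> True"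
| "has_leaf G Hub j \<longleftrightarrow> j \<noteq> 0"

fun edge :: "nat pair_pre_digraph \<Rightarrow> vertex \<Rightarrow> vertex \<Rightarrow> bool" where
  "edge G (Core x) (Core y) \<longleftrightarrow> core_edge G x y"
| "edge G (Core x) (Leaf y j) \<longleftrightarrow> x = y \<and> has_leaf G x j"
| "edge G (Leaf x i) _ \<longleftrightarrow> False"

text \<open>The hub comes first, so that the head of a characteristic vector tells whether the alliance is
  a single leaf.\<close>

definition cores :: "nat \<Rightarrow> core list" where
  "cores n = Hub # map Element [0..<n] @ map Constraint [0..<n] @ map Forced [0..<n]"

text \<open>Every core vertex gets \<open>n + 2\<close> leaves, attached or not, so that the list
  depends on \<open>n\<close> alone and is known before any adjacency is read. \<open>n + 2\<close>
  is the largest number attached, at a \<open>Forced\<close> vertex.\<close>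

definition vertices :: "nat \<Rightarrow> vertex list" where
  "vertices n = map Core (cores n) @ concat (map (\<lambda>x. map (Leaf x) [0..<n + 2]) (cores n))"

definition reduction_graph :: "nat pair_pre_digraph \<Rightarrow> vertex pair_pre_digraph" where
  "reduction_graph G = (let V = set (vertices (card (pverts G))) in
     \<lparr>pverts = V, parcs = {(p, q) \<in> V \<times> V. edge G p q \<or> edge G q p}\<rparr>)"

lemma card_Element_Forced:
  "finite I \<Longrightarrow> finite J \<Longrightarrow> card (Element ` I \<union> Forced ` J) = card I + card J"
  by (subst card_Un_disjoint) (auto simp: card_image inj_on_def)

lemma set_cores:
  "set (cores n) = insert Hub (Element ` {..<n} \<union> Constraint ` {..<n} \<union> Forced ` {..<n})"
  by (auto simp: cores_def)

lemma set_vertices: "set (vertices n) = Core ` set (cores n) \<union> case_prod Leaf ` (set (cores n) \<times> {..<n + 2})"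
  by (auto simp: vertices_def simp del: upt_Suc)

lemma distinct_cores: "distinct (cores n)"
  by (auto simp: cores_def distinct_map inj_on_def)

lemma distinct_vertices: "distinct (vertices n)"
proof -
  have "distinct (concat (map (\<lambda>x. map (Leaf x) js) xs))" if "distinct xs" "distinct js" for xs js
    using that by (induction xs) (auto simp: distinct_map inj_on_def)
  then show ?thesis
    by (auto simp: vertices_def distinct_map inj_on_def distinct_cores simp del: upt_Suc)
qed

lemma vertices_nth_0: "vertices n ! 0 = Core Hub"
  by (simp add: vertices_def cores_def)

text \<open>The bits after the hub bit thus spell out the dominating set; \<open>decode\<close>
  reads them.\<close>

lemma vertices_nth_Suc: "i < n \<Longrightarrow> vertices n ! Suc i = Core (Element i)"
  by (simp add: vertices_def cores_def nth_append)

lemma length_cores: "length (cores n) = 3 * n + 1"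
  by (simp add: cores_def)

lemma length_vertices: "length (vertices n) = (3 * n + 1) * (n + 3)"
proof -
  have "length (concat (map (\<lambda>x. map (Leaf x) js) xs)) = length xs * length js" for xs js
    by (induction xs) auto
  then show ?thesis
    by (simp add: vertices_def length_cores algebra_simps del: upt_Suc)
qed

lemma pverts_reduction_graph: "pverts (reduction_graph G) = set (vertices (card (pverts G)))"
  by (simp add: reduction_graph_def Let_def)

lemma parcs_reduction_graph:
  "(p, q) \<in> parcs (reduction_graph G) \<longleftrightarrow>
     p \<in> pverts (reduction_graph G) \<and> q \<in> pverts (reduction_graph G) \<and> (edge G p q \<or> edge G q p)"
  by (auto simp: reduction_graph_def Let_def)

primrec constraint_side :: "core \<Rightarrow> bool" where
  "constraint_side (Element i) = False"
| "constraint_side (Constraint i) = True"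
| "constraint_side (Forced i) = False"
| "constraint_side Hub = True"

primrec side :: "vertex \<Rightarrow> bool" where
  "side (Core x) = constraint_side x"
| "side (Leaf x j) = (\<not> constraint_side x)"

text \<open>Besides the bipartition this gives freedom from loops, which an input graph
  needs.\<close>

lemma edge_side: "edge G p q \<Longrightarrow> side p \<noteq> side q"
proof (induction G p q rule: edge.induct)
  case (1 G x y)
  then show ?case
    by (cases x; cases y) auto
qed auto

lemma bipartite_reduction_graph: "bipartite (reduction_graph G)"
  unfolding bipartite_def
  by (rule exI[of _ "{p \<in> pverts (reduction_graph G). side p}"],
      rule exI[of _ "{p \<in> pverts (reduction_graph G). \<not> side p}"])
    (auto simp: parcs_reduction_graph dest: edge_side)


section \<open>Minimal alliances of the reduction graph\<close>

locale dominating_set_instance =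
  fixes G :: "nat pair_pre_digraph" and n :: nat
  assumes graph: "pair_graph G" and verts: "pverts G = {..<n}"
begin

abbreviation H :: "vertex pair_pre_digraph" where
  "H \<equiv> reduction_graph G"

definition nbhd :: "nat \<Rightarrow> nat set" where
  "nbhd v = {w. closed_adj G v w}"

definition core_nbrs :: "core \<Rightarrow> core set" where
  "core_nbrs x = {y \<in> set (cores n). core_edge G x y \<or> core_edge G y x}"

definition leaf_nbrs :: "core \<Rightarrow> nat set" where
  "leaf_nbrs x = {j. j < n + 2 \<and> has_leaf G x j}"

lemma pverts_H: "pverts H = set (vertices n)"
  by (simp add: pverts_reduction_graph verts)

lemma closed_adj_sym: "closed_adj G v w \<longleftrightarrow> closed_adj G w v"
proof -
  interpret pair_graph G by (rule graph)
  show ?thesis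
    unfolding closed_adj_def using arcs_symmetric by auto
qed

lemma nbhd_subset: "v < n \<Longrightarrow> nbhd v \<subseteq> {..<n}"
proof -
  interpret pair_graph G by (rule graph)
  show "nbhd v \<subseteq> {..<n}" if "v < n"
    using that in_arcsD2 verts by (auto simp: nbhd_def closed_adj_def)
qed

lemma finite_nbhd: "v < n \<Longrightarrow> finite (nbhd v)"
  using nbhd_subset finite_subset by blast

lemma mem_nbhd: "v \<in> nbhd v"
  by (simp add: nbhd_def closed_adj_def)

text \<open>With closed neighbourhoods domination becomes a hitting set condition, which a
  constraint can test by counting.\<close>

lemma dominating_set_iff:
  "dominating_set G D \<longleftrightarrow> D \<subseteq> {..<n} \<and> (\<forall>v<n. nbhd v \<inter> D \<noteq> {})"
  unfolding dominating_set_def verts nbhd_def closed_adj_def by blast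

text \<open>The first equation rests on symmetry: the constraints that see \<open>Element i\<close>
  are those \<open>v\<close> with \<open>i\<close> in \<open>nbhd v\<close>.\<close>

lemma core_nbrs_simps:
  "i < n \<Longrightarrow> core_nbrs (Element i) = Constraint ` nbhd i"
  "v < n \<Longrightarrow> core_nbrs (Constraint v) = Element ` nbhd v \<union> Forced ` {..<n}"
  "core_nbrs (Forced i) = insert Hub (Constraint ` {..<n})"
  "core_nbrs Hub = Forced ` {..<n}"
  using nbhd_subset[of i] nbhd_subset[of v]
  by (auto simp: core_nbrs_def set_cores nbhd_def closed_adj_sym[of i])

text \<open>Indexing the leaves of a constraint by the complement of \<open>nbhd v\<close> equalises
  the degrees of all constraints without counting a neighbourhood.\<close>

lemma leaf_nbrs_simps:
  "leaf_nbrs (Element i) = {0}"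
  "leaf_nbrs (Constraint v) = {..<n + 2} - nbhd v"
  "leaf_nbrs (Forced i) = {..<n + 2}"
  "leaf_nbrs Hub = {1..<n + 2}"
  by (auto simp: leaf_nbrs_def nbhd_def)

lemma finite_core_nbrs: "finite (core_nbrs x)"
  by (rule finite_subset[of _ "set (cores n)"]) (auto simp: core_nbrs_def)

lemma core_nbrs_subset: "core_nbrs x \<subseteq> set (cores n)"
  by (auto simp: core_nbrs_def)

lemma nbrs_Core:
  assumes "x \<in> set (cores n)"
  shows "{q. (Core x, q) \<in> parcs H} = Core ` core_nbrs x \<union> Leaf x ` leaf_nbrs x"
proof (intro set_eqI)
  fix q
  show "q \<in> {q. (Core x, q) \<in> parcs H} \<longleftrightarrow> q \<in> Core ` core_nbrs x \<union> Leaf x ` leaf_nbrs x"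
    using assms
    by (cases q) (auto simp: parcs_reduction_graph pverts_H set_vertices core_nbrs_def leaf_nbrs_def)
qed

lemma nbrs_Leaf: "{q. (Leaf x j, q) \<in> parcs H} \<subseteq> {Core x}"
proof
  fix q assume "q \<in> {q. (Leaf x j, q) \<in> parcs H}"
  then show "q \<in> {Core x}"
    by (cases q) (auto simp: parcs_reduction_graph)
qed

lemma deg_in_Core:
  assumes "x \<in> set (cores n)" "A \<subseteq> set (cores n)"
  shows "deg_in H (Core ` A) (Core x) = card (core_nbrs x \<inter> A)"
    and "deg_in H (pverts H - Core ` A) (Core x) = card (core_nbrs x - A) + card (leaf_nbrs x)"
proof -
  have nbr: "(Core x, q) \<in> parcs H \<longleftrightarrow> q \<in> Core ` core_nbrs x \<union> Leaf x ` leaf_nbrs x" for q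
    using nbrs_Core[OF assms(1)] by blast
  have "{q \<in> Core ` A. (Core x, q) \<in> parcs H} = Core ` (core_nbrs x \<inter> A)"
    by (auto simp: nbr)
  then show "deg_in H (Core ` A) (Core x) = card (core_nbrs x \<inter> A)"
    by (simp add: deg_in_def card_image inj_on_def)
  have "{q \<in> pverts H - Core ` A. (Core x, q) \<in> parcs H}
      = Core ` (core_nbrs x - A) \<union> Leaf x ` leaf_nbrs x"
    using assms(1) core_nbrs_subset[of x]
    by (auto simp: nbr pverts_H set_vertices leaf_nbrs_def)
  moreover have "card (Core ` (core_nbrs x - A) \<union> Leaf x ` leaf_nbrs x)
      = card (core_nbrs x - A) + card (leaf_nbrs x)"
    by (subst card_Un_disjoint)
      (auto simp: card_image inj_on_def finite_core_nbrs leaf_nbrs_def)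
  ultimately show "deg_in H (pverts H - Core ` A) (Core x) = card (core_nbrs x - A) + card (leaf_nbrs x)"
    by (simp add: deg_in_def)
qed

text \<open>Leaves are never inside, so they enter as a fixed handicap
  \<open>card (leaf_nbrs x)\<close>.\<close>

lemma alliance_cores_iff:
  assumes "A \<subseteq> set (cores n)"
  shows "defensive_alliance H (Core ` A) \<longleftrightarrow>
    (\<forall>x\<in>A. card (core_nbrs x - A) + card (leaf_nbrs x) \<le> card (core_nbrs x \<inter> A) + 1)"
proof -
  have "Core ` A \<subseteq> pverts H"
    using assms by (auto simp: pverts_H set_vertices)
  moreover have "deg_in H (Core ` A) (Core x) = card (core_nbrs x \<inter> A)"
    "deg_in H (pverts H - Core ` A) (Core x) = card (core_nbrs x - A) + card (leaf_nbrs x)"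
    if "x \<in> A" for x
    by (fact deg_in_Core[OF subsetD[OF assms that] assms])+
  ultimately show ?thesis
    by (simp add: defensive_alliance_def)
qed

section \<open>Demands of the single vertices\<close>

lemma alliance_Leaf:
  assumes "Leaf x j \<in> pverts H"
  shows "defensive_alliance H {Leaf x j}"
proof -
  have "deg_in H (pverts H - {Leaf x j}) (Leaf x j) \<le> card {Core x}"
    unfolding deg_in_def using nbrs_Leaf[of x j] by (intro card_mono) auto
  then show ?thesis
    using assms by (auto simp: defensive_alliance_def)
qed

text \<open>The leaf already uses up the allowance of 1, and \<open>Constraint i\<close> is a
  further neighbour, so some neighbour must be inside.\<close>

lemma alliance_Element:
  assumes A: "A \<subseteq> set (cores n)" "defensive_alliance H (Core ` A)" and i: "Element i \<in> A"
  obtains v where "Constraint v \<in> A"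
proof -
  have "i < n"
    using A i by (auto simp: set_cores)
  moreover have "core_nbrs (Element i) \<inter> A \<noteq> {}"
  proof
    assume "core_nbrs (Element i) \<inter> A = {}"
    moreover from this have "core_nbrs (Element i) - A = core_nbrs (Element i)"
      by blast
    ultimately have "card (core_nbrs (Element i)) = 0"
      using i A by (auto simp: alliance_cores_iff leaf_nbrs_simps)
    then show False
      using \<open>i < n\<close> mem_nbhd[of i] finite_nbhd[of i] by (auto simp: core_nbrs_simps card_image)
  qed
  ultimately show thesis
    using that by (auto simp: core_nbrs_simps)
qed

text \<open>The size of \<open>nbhd v\<close> cancels: with \<open>k\<close> core neighbours inside,
  the condition reads \<open>2 * n + 2 \<le> 2 * k + 1\<close>, and parity gives
  \<open>n + 1 \<le> k\<close>.\<close>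

lemma alliance_Constraint:
  assumes A: "A \<subseteq> set (cores n)" "defensive_alliance H (Core ` A)" and v: "Constraint v \<in> A"
  shows "n + 1 \<le> card (nbhd v \<inter> {i. Element i \<in> A}) + card {i. i < n \<and> Forced i \<in> A}"
proof -
  have vn: "v < n"
    using A v by (auto simp: set_cores)
  have fin: "finite (nbhd v)" and sub: "nbhd v \<subseteq> {..<n}"
    using vn by (auto simp: finite_nbhd nbhd_subset)
  let ?k = "card (core_nbrs (Constraint v) \<inter> A)"
  have "card (leaf_nbrs (Constraint v)) = n + 2 - card (nbhd v)"
    unfolding leaf_nbrs_simps using card_Diff_subset[of "nbhd v" "{..<n + 2}"] fin sub by fastforce
  moreover have "card (nbhd v) \<le> n"
    using card_mono[OF _ sub] by simp
  moreover have "card (core_nbrs (Constraint v)) = card (nbhd v) + n"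
    using fin by (simp add: core_nbrs_simps(2)[OF vn] card_Element_Forced)
  moreover have "card (core_nbrs (Constraint v)) = ?k + card (core_nbrs (Constraint v) - A)"
    by (metis card_Diff_subset_Int card_mono finite_Int finite_core_nbrs inf_le1 le_add_diff_inverse)
  moreover have "card (core_nbrs (Constraint v) - A) + card (leaf_nbrs (Constraint v)) \<le> ?k + 1"
    using A v by (auto simp: alliance_cores_iff)
  moreover have "?k = card (nbhd v \<inter> {i. Element i \<in> A}) + card {i. i < n \<and> Forced i \<in> A}"
  proof -
    have "core_nbrs (Constraint v) \<inter> A
        = Element ` (nbhd v \<inter> {i. Element i \<in> A}) \<union> Forced ` {i. i < n \<and> Forced i \<in> A}"
      unfolding core_nbrs_simps(2)[OF vn] by auto
    then show ?thesis
      using fin by (simp add: card_Element_Forced)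
  qed
  ultimately show ?thesis
    by linarith
qed

text \<open>Of \<open>n + 1\<close> core neighbours let \<open>r\<close> be outside:
  \<open>r + n + 2 \<le> (n + 1 - r) + 1\<close> leaves only \<open>r = 0\<close>. The count at the
  hub is the same with \<open>n\<close> neighbours and \<open>n + 1\<close> leaves.\<close>

lemma alliance_Forced:
  assumes A: "A \<subseteq> set (cores n)" "defensive_alliance H (Core ` A)" and i: "Forced i \<in> A"
  shows "insert Hub (Constraint ` {..<n}) \<subseteq> A"
proof -
  let ?N = "insert Hub (Constraint ` {..<n})"
  have "card ?N = n + 1"
    by (subst card_insert_disjoint) (auto simp: card_image inj_on_def)
  moreover have "card ?N = card (?N \<inter> A) + card (?N - A)"
    by (metis card_Diff_subset_Int card_mono finite_Int finite_core_nbrs inf_le1 le_add_diff_inverse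
        core_nbrs_simps(3))
  moreover have "card (?N - A) + (n + 2) \<le> card (?N \<inter> A) + 1"
    using A i by (auto simp: alliance_cores_iff leaf_nbrs_simps core_nbrs_simps)
  ultimately have "card (?N - A) = 0"
    by linarith
  then show ?thesis
    by simp
qed

lemma alliance_Hub:
  assumes A: "A \<subseteq> set (cores n)" "defensive_alliance H (Core ` A)" and "Hub \<in> A"
  shows "Forced ` {..<n} \<subseteq> A"
proof -
  let ?N = "Forced ` {..<n}"
  have "card ?N = n"
    by (auto simp: card_image inj_on_def)
  moreover have "card ?N = card (?N \<inter> A) + card (?N - A)"
    by (metis card_Diff_subset_Int card_mono finite_Int finite_core_nbrs inf_le1 le_add_diff_inverse
        core_nbrs_simps(4))
  moreover have "card (?N - A) + (n + 1) \<le> card (?N \<inter> A) + 1"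
    using assms by (auto simp: alliance_cores_iff leaf_nbrs_simps core_nbrs_simps)
  ultimately have "card (?N - A) = 0"
    by linarith
  then show ?thesis
    by simp
qed

definition dominating_alliance :: "nat set \<Rightarrow> core set" where
  "dominating_alliance D =
     Element ` D \<union> insert Hub (Constraint ` {..<n} \<union> Forced ` {..<n})"

text \<open>Membership spreads from element to constraint to forced vertex to hub; the hub then
  claims all forced vertices, and these all constraints. Only the set of elements stays
  free.\<close>

lemma alliance_cores_imp:
  assumes A: "A \<subseteq> set (cores n)" "defensive_alliance H (Core ` A)" and "A \<noteq> {}"
  obtains D where "A = dominating_alliance D" "dominating_set G D"
proof -
  have Hub_if_Forced: "Hub \<in> A" if "Forced i \<in> A" for i
    using alliance_Forced[OF A that] by blast
  have Hub_if_Constraint: "Hub \<in> A" if v: "Constraint v \<in> A" for v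
  proof -
    have "v < n"
      using A v by (auto simp: set_cores)
    then have "card (nbhd v \<inter> {i. Element i \<in> A}) \<le> n"
      using card_mono[of "{..<n}" "nbhd v \<inter> {i. Element i \<in> A}"] nbhd_subset[of v] by auto
    \<comment> \<open>At most \<open>n\<close> of the \<open>n + 1\<close> required neighbours are
      elements, so a forced vertex is present.\<close>
    then have "card {i. i < n \<and> Forced i \<in> A} \<noteq> 0"
      using alliance_Constraint[OF A v] by linarith
    then have "{i. i < n \<and> Forced i \<in> A} \<noteq> {}"
      by force
    then show "Hub \<in> A"
      using Hub_if_Forced by blast
  qed
  have "Hub \<in> A"
  proof -
    obtain x where x: "x \<in> A"
      using \<open>A \<noteq> {}\<close> by blast
    show ?thesis
    proof (cases x)
      case (Element i)
      then show ?thesis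
        using x alliance_Element[OF A] Hub_if_Constraint by blast
    qed (use x Hub_if_Constraint Hub_if_Forced in auto)
  qed
  then have Forced: "Forced ` {..<n} \<subseteq> A"
    using alliance_Hub[OF A] by blast
  \<comment> \<open>Any forced vertex pulls in all constraints; for \<open>n = 0\<close> there is no
    forced vertex, but no constraint either.\<close>
  have Constraint: "Constraint ` {..<n} \<subseteq> A"
    using alliance_Forced[OF A] Forced by (cases n) auto
  define D where "D = {i. Element i \<in> A}"
  have "A = dominating_alliance D"
    using A(1) \<open>Hub \<in> A\<close> Forced Constraint
    by (auto simp: dominating_alliance_def D_def set_cores)
  moreover have "dominating_set G D"
    unfolding dominating_set_iff
  proof (intro conjI allI impI)
    show "D \<subseteq> {..<n}"
      using A(1) by (auto simp: D_def set_cores)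
    fix v assume "v < n"
    then have "n + 1 \<le> card (nbhd v \<inter> D) + card {i. i < n \<and> Forced i \<in> A}"
      unfolding D_def using Constraint by (intro alliance_Constraint[OF A]) auto
    \<comment> \<open>Conversely the forced vertices supply at most \<open>n\<close>, so an element
      from \<open>nbhd v\<close> remains.\<close>
    moreover have "card {i. i < n \<and> Forced i \<in> A} \<le> n"
      using card_mono[of "{..<n}" "{i. i < n \<and> Forced i \<in> A}"] by auto
    ultimately show "nbhd v \<inter> D \<noteq> {}"
      by auto
  qed
  ultimately show thesis
    by (rule that)
qed

section \<open>From dominating sets back to alliances\<close>

lemma dominating_alliance_subset: "D \<subseteq> {..<n} \<Longrightarrow> dominating_alliance D \<subseteq> set (cores n)"
  by (auto simp: dominating_alliance_def set_cores)

lemma Element_mem_dominating_alliance [simp]: "Element i \<in> dominating_alliance D \<longleftrightarrow> i \<in> D"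
  by (auto simp: dominating_alliance_def)

text \<open>Such alliances differ only in their elements, so minimality passes between them and
  dominating sets.\<close>

lemma dominating_alliance_psubset_iff: "dominating_alliance D' \<subset> dominating_alliance D \<longleftrightarrow> D' \<subset> D"
  unfolding psubset_eq dominating_alliance_def by blast

lemma alliance_dominating_alliance:
  assumes "dominating_set G D"
  shows "defensive_alliance H (Core ` dominating_alliance D)"
proof -
  let ?A = "dominating_alliance D"
  have D: "D \<subseteq> {..<n}" "\<And>v. v < n \<Longrightarrow> nbhd v \<inter> D \<noteq> {}"
    using assms by (auto simp: dominating_set_iff)
  have "card (core_nbrs x - ?A) + card (leaf_nbrs x) \<le> card (core_nbrs x \<inter> ?A) + 1"
    if x: "x \<in> ?A" for x
  proof (cases x)
    case (Element i)
    then have "i < n"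
      using x D by auto
    then have "core_nbrs x - ?A = {}"
      using nbhd_subset[of i] Element by (auto simp: core_nbrs_simps dominating_alliance_def)
    then have "card (core_nbrs x - ?A) = 0"
      by (simp only: card.empty)
    moreover have "card (leaf_nbrs x) = 1"
      by (simp add: Element leaf_nbrs_simps)
    ultimately show ?thesis
      by linarith
  next
    case (Constraint v)
    then have vn: "v < n"
      using x by (auto simp: dominating_alliance_def)
    have fin: "finite (nbhd v)" and sub: "nbhd v \<subseteq> {..<n}"
      using vn by (auto simp: finite_nbhd nbhd_subset)
    have "core_nbrs x - ?A = Element ` (nbhd v - D)"
      using vn by (auto simp: Constraint core_nbrs_simps dominating_alliance_def)
    then have "card (core_nbrs x - ?A) = card (nbhd v - D)"
      by (simp add: card_image inj_on_def)
    also have "\<dots> = card (nbhd v) - card (nbhd v \<inter> D)"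
      using fin by (simp add: card_Diff_subset_Int)
    finally have out: "card (core_nbrs x - ?A) = card (nbhd v) - card (nbhd v \<inter> D)" .
    have "core_nbrs x \<inter> ?A = Element ` (nbhd v \<inter> D) \<union> Forced ` {..<n}"
      using vn by (auto simp: Constraint core_nbrs_simps dominating_alliance_def)
    then have inside: "card (core_nbrs x \<inter> ?A) = card (nbhd v \<inter> D) + n"
      using fin by (simp add: card_Element_Forced)
    have leaves: "card (leaf_nbrs x) = n + 2 - card (nbhd v)"
      unfolding Constraint leaf_nbrs_simps
      using card_Diff_subset[of "nbhd v" "{..<n + 2}"] fin sub by fastforce
    \<comment> \<open>With \<open>c\<close> elements of \<open>D\<close> in \<open>nbhd v\<close>
      the demand reads \<open>n + 2 - c \<le> n + c + 1\<close>, true as soon as \<open>c\<close> is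
      at least 1.\<close>
    have "card (nbhd v) \<le> n" "card (nbhd v \<inter> D) \<le> card (nbhd v)" "card (nbhd v \<inter> D) \<ge> 1"
      using card_mono[OF _ sub] card_mono[OF fin, of "nbhd v \<inter> D"] D(2)[OF vn] fin
      by (auto simp: Suc_le_eq card_gt_0_iff)
    then show ?thesis
      unfolding out inside leaves by linarith
  next
    case (Forced i)
    have "card (core_nbrs x - ?A) = 0" "core_nbrs x \<inter> ?A = insert Hub (Constraint ` {..<n})"
      by (auto simp: card_eq_0_iff Forced core_nbrs_simps dominating_alliance_def)
    moreover have "card (insert Hub (Constraint ` {..<n})) = n + 1"
      by (subst card_insert_disjoint) (auto simp: card_image inj_on_def)
    ultimately show ?thesis
      by (simp add: Forced leaf_nbrs_simps)
  next
    case Hub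
    have "card (core_nbrs x - ?A) = 0" "core_nbrs x \<inter> ?A = Forced ` {..<n}"
      by (auto simp: card_eq_0_iff Hub core_nbrs_simps dominating_alliance_def)
    moreover have "card (Forced ` {..<n}) = n"
      by (auto simp: card_image inj_on_def)
    ultimately show ?thesis
      by (simp add: Hub leaf_nbrs_simps)
  qed
  then show ?thesis
    using dominating_alliance_subset[OF D(1)] by (simp add: alliance_cores_iff)
qed

section \<open>Classification of the minimal alliances\<close>

lemma minimal_alliance_with_leaf:
  assumes "globally_minimal_defensive_alliance H A" "Leaf x j \<in> A"
  shows "A = {Leaf x j}"
proof -
  have "Leaf x j \<in> pverts H"
    using assms by (auto simp: globally_minimal_defensive_alliance_def defensive_alliance_def)
  then show ?thesis
    using assms alliance_Leaf unfolding globally_minimal_defensive_alliance_def by blast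
qed

lemma leafless_set:
  assumes "A \<subseteq> pverts H" "\<And>x j. Leaf x j \<notin> A"
  obtains A' where "A' \<subseteq> set (cores n)" "A = Core ` A'"
proof
  show "{x. Core x \<in> A} \<subseteq> set (cores n)" "A = Core ` {x. Core x \<in> A}"
    using assms by (auto simp: pverts_H set_vertices)
qed

text \<open>The condition \<open>p \<noteq> Core Hub\<close> makes the cases recognisable by the
  hub. For \<open>n = 0\<close> the singleton \<open>{Core Hub}\<close> falls under the second case,
  with \<open>D = {}\<close>.\<close>

lemma minimal_alliance_cases:
  assumes A: "globally_minimal_defensive_alliance H A"
  obtains p where "p \<in> pverts H" "A = {p}" "p \<noteq> Core Hub"
  | D where "minimal_dominating_set G D" "A = Core ` dominating_alliance D"
proof (cases "\<exists>x j. Leaf x j \<in> A")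
  case True
  then obtain x j where "Leaf x j \<in> A"
    by blast
  moreover have "A \<subseteq> pverts H"
    using A by (auto simp: globally_minimal_defensive_alliance_def defensive_alliance_def)
  ultimately show thesis
    using that(1)[of "Leaf x j"] minimal_alliance_with_leaf[OF A] by blast
next
  case False
  have "A \<subseteq> pverts H"
    using A by (auto simp: globally_minimal_defensive_alliance_def defensive_alliance_def)
  then obtain A' where A': "A' \<subseteq> set (cores n)" "A = Core ` A'"
    using leafless_set False by metis
  then have "defensive_alliance H (Core ` A')" "A' \<noteq> {}"
    using A by (auto simp: globally_minimal_defensive_alliance_def)
  then obtain D where D: "A' = dominating_alliance D" "dominating_set G D"
    using alliance_cores_imp[OF A'(1)] by metis
  have "\<not> dominating_set G D'" if "D' \<subset> D" for D'
  proof
    assume "dominating_set G D'"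
    moreover have "Core ` dominating_alliance D' \<subset> A"
      using that dominating_alliance_psubset_iff[of D' D]
      by (simp add: A' D(1) image_strict_mono inj_on_def)
    moreover have "Core ` dominating_alliance D' \<noteq> {}"
      by (simp add: dominating_alliance_def)
    ultimately show False
      using A alliance_dominating_alliance unfolding globally_minimal_defensive_alliance_def by blast
  qed
  then show thesis
    using that(2) A' D by (auto simp: minimal_dominating_set_def)
qed

text \<open>A subset of a leafless set is leafless, so a smaller alliance would again come from a
  dominating set, and from a smaller one.\<close>

lemma minimal_alliance_dominating_alliance:
  assumes D: "minimal_dominating_set G D"
  shows "globally_minimal_defensive_alliance H (Core ` dominating_alliance D)"
  unfolding globally_minimal_defensive_alliance_def
proof (intro conjI notI)
  show "defensive_alliance H (Core ` dominating_alliance D)"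
    using D alliance_dominating_alliance by (simp add: minimal_dominating_set_def)
  show False if empty: "Core ` dominating_alliance D = {}"
    using empty by (simp add: dominating_alliance_def)
  assume "\<exists>B. B \<subset> Core ` dominating_alliance D \<and> B \<noteq> {} \<and> defensive_alliance H B"
  then obtain B where B: "B \<subset> Core ` dominating_alliance D" "B \<noteq> {}" "defensive_alliance H B"
    by blast
  moreover have "B \<subseteq> pverts H"
    using B by (simp add: defensive_alliance_def)
  ultimately obtain B' where B': "B' \<subseteq> set (cores n)" "B = Core ` B'"
    using leafless_set[of B] by blast
  then have "defensive_alliance H (Core ` B')" "B' \<noteq> {}"
    using B by auto
  then obtain D' where D': "B' = dominating_alliance D'" "dominating_set G D'"
    using alliance_cores_imp[OF B'(1)] by metis
  have "dominating_alliance D' \<subset> dominating_alliance D"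
    using B(1) unfolding B'(2) D'(1) by (auto simp: psubset_eq inj_image_subset_iff inj_def)
  then show False
    using D D'(2) by (simp add: dominating_alliance_psubset_iff minimal_dominating_set_def)
qed

end


section \<open>Relabelling of vertices\<close>

definition index_graph :: "'a list \<Rightarrow> 'a pair_pre_digraph \<Rightarrow> nat pair_pre_digraph" where
  "index_graph vs H = \<lparr>pverts = {..<length vs},
     parcs = {(i, j). i < length vs \<and> j < length vs \<and> (vs ! i, vs ! j) \<in> parcs H}\<rparr>"

context
  fixes vs :: "'a list" and H :: "'a pair_pre_digraph"
  assumes distinct: "distinct vs" and set_vs: "set vs = pverts H"
begin

lemma inj_on_nth_vs: "inj_on ((!) vs) {..<length vs}"
  using distinct by (simp add: inj_on_nth)

lemma image_nth_vs: "(!) vs ` {..<length vs} = pverts H"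
  using set_vs by (auto simp: set_conv_nth)

lemma deg_in_index_graph:
  assumes "X \<subseteq> {..<length vs}" "i < length vs"
  shows "deg_in (index_graph vs H) X i = deg_in H ((!) vs ` X) (vs ! i)"
proof -
  have "{q \<in> (!) vs ` X. (vs ! i, q) \<in> parcs H} = (!) vs ` {j \<in> X. (i, j) \<in> parcs (index_graph vs H)}"
    using assms by (auto simp: index_graph_def)
  moreover have "inj_on ((!) vs) {j \<in> X. (i, j) \<in> parcs (index_graph vs H)}"
    using assms(1) by (intro inj_on_subset[OF inj_on_nth_vs]) auto
  ultimately show ?thesis
    by (simp add: deg_in_def card_image)
qed

text \<open>The range condition is explicit because \<open>vs ! i\<close> is unspecified past the
  end of the list.\<close>

lemma defensive_alliance_index_graph:
  "defensive_alliance (index_graph vs H) X \<longleftrightarrow>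
     X \<subseteq> {..<length vs} \<and> defensive_alliance H ((!) vs ` X)"
proof (cases "X \<subseteq> {..<length vs}")
  case True
  have compl: "(!) vs ` ({..<length vs} - X) = pverts H - (!) vs ` X"
    using inj_on_image_set_diff[OF inj_on_nth_vs, of "{..<length vs}" X] True image_nth_vs by simp
  have "deg_in (index_graph vs H) X i = deg_in H ((!) vs ` X) (vs ! i)"
    "deg_in (index_graph vs H) ({..<length vs} - X) i = deg_in H (pverts H - (!) vs ` X) (vs ! i)"
    if "i \<in> X" for i
  proof -
    have "i < length vs"
      using that True by auto
    then show "deg_in (index_graph vs H) X i = deg_in H ((!) vs ` X) (vs ! i)"
      "deg_in (index_graph vs H) ({..<length vs} - X) i = deg_in H (pverts H - (!) vs ` X) (vs ! i)"
      using deg_in_index_graph[of X i] deg_in_index_graph[of "{..<length vs} - X" i] True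
      by (simp_all only: compl Diff_subset)
  qed
  moreover have "(!) vs ` X \<subseteq> pverts H"
    using True image_nth_vs by blast
  moreover have "pverts (index_graph vs H) = {..<length vs}"
    by (simp add: index_graph_def)
  ultimately show ?thesis
    using True by (simp add: defensive_alliance_def)
qed (simp add: defensive_alliance_def index_graph_def)

lemma globally_minimal_defensive_alliance_index_graph:
  "globally_minimal_defensive_alliance (index_graph vs H) X \<longleftrightarrow>
     X \<subseteq> {..<length vs} \<and> globally_minimal_defensive_alliance H ((!) vs ` X)"
proof (cases "X \<subseteq> {..<length vs}")
  case True
  have "(\<exists>B. B \<subset> (!) vs ` X \<and> B \<noteq> {} \<and> defensive_alliance H B) \<longleftrightarrow>
      (\<exists>B. B \<subset> X \<and> B \<noteq> {} \<and> defensive_alliance (index_graph vs H) B)"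
  proof
    assume "\<exists>B. B \<subset> (!) vs ` X \<and> B \<noteq> {} \<and> defensive_alliance H B"
    then obtain B where B: "B \<subset> (!) vs ` X" "B \<noteq> {}" "defensive_alliance H B"
      by blast
    then obtain B' where B': "B' \<subseteq> X" "B = (!) vs ` B'"
      by (meson psubset_imp_subset subset_imageE)
    with B True have "B' \<subset> X" "B' \<noteq> {}" "defensive_alliance (index_graph vs H) B'"
      by (auto simp: defensive_alliance_index_graph)
    then show "\<exists>B. B \<subset> X \<and> B \<noteq> {} \<and> defensive_alliance (index_graph vs H) B"
      by blast
  next
    assume "\<exists>B. B \<subset> X \<and> B \<noteq> {} \<and> defensive_alliance (index_graph vs H) B"
    then obtain B where B: "B \<subset> X" "B \<noteq> {}" "defensive_alliance (index_graph vs H) B"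
      by blast
    moreover have "(!) vs ` B \<subset> (!) vs ` X"
      using B(1) inj_on_subset[OF inj_on_nth_vs True] by (rule image_strict_mono[rotated])
    ultimately show "\<exists>B. B \<subset> (!) vs ` X \<and> B \<noteq> {} \<and> defensive_alliance H B"
      unfolding defensive_alliance_index_graph by (metis image_is_empty)
  qed
  then show ?thesis
    using True by (auto simp: globally_minimal_defensive_alliance_def defensive_alliance_index_graph)
qed (auto simp: globally_minimal_defensive_alliance_def defensive_alliance_index_graph)

lemma bipartite_index_graph:
  assumes "bipartite H"
  shows "bipartite (index_graph vs H)"
proof -
  obtain X Y where XY: "X \<union> Y = pverts H" "X \<inter> Y = {}" "parcs H \<subseteq> X \<times> Y \<union> Y \<times> X"
    using assms by (auto simp: bipartite_def)
  show ?thesis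
    unfolding bipartite_def
  proof (intro exI conjI)
    show "{i. i < length vs \<and> vs ! i \<in> X} \<union> {i. i < length vs \<and> vs ! i \<in> Y} = pverts (index_graph vs H)"
      using XY(1) set_vs nth_mem[of _ vs] by (auto simp: index_graph_def)
    show "{i. i < length vs \<and> vs ! i \<in> X} \<inter> {i. i < length vs \<and> vs ! i \<in> Y} = {}"
      using XY(2) by auto
    show "parcs (index_graph vs H) \<subseteq>
        {i. i < length vs \<and> vs ! i \<in> X} \<times> {i. i < length vs \<and> vs ! i \<in> Y} \<union>
        {i. i < length vs \<and> vs ! i \<in> Y} \<times> {i. i < length vs \<and> vs ! i \<in> X}"
      using XY(3) by (auto simp: index_graph_def)
  qed
qed

end

lemma input_graph_index_graph:
  assumes "\<And>p q. (p, q) \<in> parcs H \<Longrightarrow> (q, p) \<in> parcs H" "\<And>p. (p, p) \<notin> parcs H"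
  shows "input_graph (index_graph vs H)"
proof -
  have "pair_graph (index_graph vs H)"
  proof
    have "parcs (index_graph vs H) \<subseteq> {..<length vs} \<times> {..<length vs}"
      by (auto simp: index_graph_def)
    then show "finite (parcs (index_graph vs H))"
      by (rule finite_subset) simp
    show "symmetric (with_proj (index_graph vs H))"
      using assms(1) by (auto simp: index_graph_def symmetric_def arcs_ends_conv intro!: symI)
  qed (use assms(2) in \<open>auto simp: index_graph_def\<close>)
  then show ?thesis
    by (auto simp: input_graph_def index_graph_def)
qed


section \<open>Correspondence of solutions\<close>

definition reduced_graph :: "nat pair_pre_digraph \<Rightarrow> nat pair_pre_digraph" where
  "reduced_graph G = index_graph (vertices (card (pverts G))) (reduction_graph G)"

lemma input_graph_reduced_graph: "input_graph (reduced_graph G)"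
  unfolding reduced_graph_def
  by (rule input_graph_index_graph) (auto simp: parcs_reduction_graph dest: edge_side)

lemma bipartite_reduced_graph: "bipartite (reduced_graph G)"
  unfolding reduced_graph_def
  by (intro bipartite_index_graph bipartite_reduction_graph distinct_vertices)
    (simp add: pverts_reduction_graph)

context dominating_set_instance
begin

definition decode :: "nat set \<Rightarrow> nat set" where
  "decode X = {i. i < n \<and> Suc i \<in> X}"

abbreviation (input) vs :: "vertex list" where
  "vs \<equiv> vertices n"

lemma reduced_graph_eq: "reduced_graph G = index_graph vs H"
  by (simp add: reduced_graph_def verts)

lemma minimal_alliance_reduced_graph:
  "globally_minimal_defensive_alliance (reduced_graph G) X \<longleftrightarrow>
     X \<subseteq> {..<length vs} \<and> globally_minimal_defensive_alliance H ((!) vs ` X)"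
  unfolding reduced_graph_eq
  by (rule globally_minimal_defensive_alliance_index_graph) (simp_all add: distinct_vertices pverts_H)

lemma inj_on_nth_vertices: "inj_on ((!) vs) {..<length vs}"
  by (simp add: inj_on_nth distinct_vertices)

lemma inj_on_image_nth_vertices: "inj_on ((`) ((!) vs)) {X. X \<subseteq> {..<length vs}}"
  using inj_on_nth_vertices by (auto simp: inj_on_def inj_on_image_eq_iff)

lemma length_vertices_gt: "n < length vs"
  by (simp add: length_vertices algebra_simps)

lemma nth_image_mem_iff:
  assumes "X \<subseteq> {..<length vs}" "i < length vs"
  shows "vs ! i \<in> (!) vs ` X \<longleftrightarrow> i \<in> X"
  using inj_on_image_mem_iff[OF inj_on_nth_vertices _ assms(1)] assms(2) by simp

lemma dominating_set_subset: "minimal_dominating_set G D \<Longrightarrow> D \<subseteq> {..<n}"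
  by (simp add: minimal_dominating_set_def dominating_set_def verts)

lemma decode_eq:
  assumes X: "X \<subseteq> {..<length vs}" "(!) vs ` X = Core ` dominating_alliance D" and D: "D \<subseteq> {..<n}"
  shows "decode X = D"
proof -
  have "Suc i \<in> X \<longleftrightarrow> i \<in> D" if "i < n" for i
  proof -
    have "Suc i \<in> X \<longleftrightarrow> vs ! Suc i \<in> (!) vs ` X"
      using nth_image_mem_iff[OF X(1), of "Suc i"] that length_vertices_gt by simp
    also have "\<dots> \<longleftrightarrow> i \<in> D"
      unfolding X(2) vertices_nth_Suc[OF that] by auto
    finally show ?thesis .
  qed
  then show ?thesis
    using D by (auto simp: decode_def)
qed

lemma minimal_alliance_decode:
  assumes X: "globally_minimal_defensive_alliance (reduced_graph G) X" "0 \<in> X"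
  shows "minimal_dominating_set G (decode X)"
    and "(!) vs ` X = Core ` dominating_alliance (decode X)"
proof -
  have sub: "X \<subseteq> {..<length vs}" and min: "globally_minimal_defensive_alliance H ((!) vs ` X)"
    using X by (auto simp: minimal_alliance_reduced_graph)
  \<comment> \<open>Position 0 is the hub, which excludes the singleton case.\<close>
  have "vs ! 0 \<in> (!) vs ` X"
    using X(2) by blast
  then have "Core Hub \<in> (!) vs ` X"
    by (simp only: vertices_nth_0)
  then obtain D where D: "minimal_dominating_set G D" "(!) vs ` X = Core ` dominating_alliance D"
    using minimal_alliance_cases[OF min] by (metis singletonD)
  then have "decode X = D"
    using decode_eq[OF sub] dominating_set_subset by blast
  with D show "minimal_dominating_set G (decode X)"
      "(!) vs ` X = Core ` dominating_alliance (decode X)"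
    by simp_all
qed

text \<open>Injective because an alliance with the hub is determined by its elements. The bijection
  makes the decoded list complete and free of repetitions.\<close>

lemma bij_betw_decode:
  "bij_betw decode {X. globally_minimal_defensive_alliance (reduced_graph G) X \<and> 0 \<in> X}
     {D. minimal_dominating_set G D}"
proof (rule bij_betw_imageI)
  let ?S = "{X. globally_minimal_defensive_alliance (reduced_graph G) X \<and> 0 \<in> X}"
  show "inj_on decode ?S"
  proof (rule inj_onI)
    fix X Y
    assume XY: "X \<in> ?S" "Y \<in> ?S" and "decode X = decode Y"
    then have "(!) vs ` X = (!) vs ` Y"
      using minimal_alliance_decode(2) by simp
    then show "X = Y"
      using XY inj_on_image_nth_vertices by (auto simp: minimal_alliance_reduced_graph inj_on_def)
  qed
  show "decode ` ?S = {D. minimal_dominating_set G D}"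
  proof (intro equalityI subsetI)
    fix D
    assume "D \<in> decode ` ?S"
    then show "D \<in> {D. minimal_dominating_set G D}"
      using minimal_alliance_decode(1) by auto
  next
    fix D
    assume "D \<in> {D. minimal_dominating_set G D}"
    then have D: "minimal_dominating_set G D" "D \<subseteq> {..<n}"
      using dominating_set_subset by auto
    define X where "X = {i. i < length vs \<and> vs ! i \<in> Core ` dominating_alliance D}"
    have sub: "X \<subseteq> {..<length vs}"
      by (auto simp: X_def)
    have "Core ` dominating_alliance D \<subseteq> set vs"
      using dominating_alliance_subset[OF D(2)] by (auto simp: set_vertices)
    then have img: "(!) vs ` X = Core ` dominating_alliance D"
      by (auto simp: X_def set_conv_nth image_def subset_iff) metis
    have "globally_minimal_defensive_alliance (reduced_graph G) X"
      using sub img minimal_alliance_dominating_alliance[OF D(1)]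
      by (simp add: minimal_alliance_reduced_graph)
    moreover have "0 \<in> X"
      using length_vertices_gt by (auto simp: X_def vertices_nth_0 dominating_alliance_def)
    moreover have "decode X = D"
      using decode_eq[OF sub img D(2)] .
    ultimately show "D \<in> decode ` ?S"
      by blast
  qed
qed

text \<open>The surplus over the wanted solutions is at most the number of vertices, so a time bound
  in the number of alliances becomes one in the number of dominating sets and the input
  size.\<close>

lemma card_minimal_alliances:
  "card {X. globally_minimal_defensive_alliance (reduced_graph G) X}
     \<le> length vs + card {D. minimal_dominating_set G D}"
proof -
  let ?S = "{X. globally_minimal_defensive_alliance (reduced_graph G) X}"
  let ?M = "{D. minimal_dominating_set G D}"
  have fin: "finite ?M"
    by (rule finite_subset[of _ "Pow {..<n}"]) (auto dest: dominating_set_subset)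
  have "inj_on ((`) ((!) vs)) ?S"
    by (rule inj_on_subset[OF inj_on_image_nth_vertices]) (auto simp: minimal_alliance_reduced_graph)
  then have "card ?S = card ((`) ((!) vs) ` ?S)"
    by (simp add: card_image)
  also have "\<dots> \<le> card ((\<lambda>p. {p}) ` set vs \<union> (\<lambda>D. Core ` dominating_alliance D) ` ?M)"
  proof (rule card_mono)
    show "(`) ((!) vs) ` ?S \<subseteq> (\<lambda>p. {p}) ` set vs \<union> (\<lambda>D. Core ` dominating_alliance D) ` ?M"
    proof
      fix A assume "A \<in> (`) ((!) vs) ` ?S"
      then have "globally_minimal_defensive_alliance H A"
        by (auto simp: minimal_alliance_reduced_graph)
      then show "A \<in> (\<lambda>p. {p}) ` set vs \<union> (\<lambda>D. Core ` dominating_alliance D) ` ?M"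
        by (cases rule: minimal_alliance_cases) (auto simp: pverts_H)
    qed
  qed (use fin in auto)
  also have "\<dots> \<le> card ((\<lambda>p. {p}) ` set vs) + card ((\<lambda>D. Core ` dominating_alliance D) ` ?M)"
    by (rule card_Un_le)
  also have "\<dots> \<le> length vs + card ?M"
    by (intro add_mono card_image_le fin) (metis List.finite_set card_image_le card_length le_trans)
  finally show ?thesis .
qed

end


section \<open>The reduction in polynomial time\<close>

text \<open>A tag from 0 to 3 and an index, both unary; the hub gets index 0. Equality of core
  vertices becomes equality of two pairs of numbers.\<close>

primrec core_data :: "core \<Rightarrow> data" where
  "core_data (Element i) = Cell (nat_data 0) (nat_data i)"
| "core_data (Constraint v) = Cell (nat_data 1) (nat_data v)"
| "core_data (Forced i) = Cell (nat_data 2) (nat_data i)"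
| "core_data Hub = Cell (nat_data 3) Atom"

text \<open>Read as a number, the left part is 0 for a core vertex and \<open>j + 1\<close> for
  \<open>Leaf x j\<close>; its tail gives back \<open>j\<close>.\<close>

primrec vertex_data :: "vertex \<Rightarrow> data" where
  "vertex_data (Core x) = Cell Atom (core_data x)"
| "vertex_data (Leaf x j) = Cell (Cell Atom (nat_data j)) (core_data x)"

text \<open>This and the following predicates are total on trees and agree with their graph
  counterparts on encodings; they use only operations with a closure rule.\<close>

definition closed_adj_data :: "data \<Rightarrow> data \<Rightarrow> data \<Rightarrow> bool" where
  "closed_adj_data g a b \<longleftrightarrow>
     data_nat a = data_nat b \<or> nth_data (nth_data g (data_nat a)) (data_nat b) \<noteq> Atom"

definition core_edge_data :: "data \<Rightarrow> data \<Rightarrow> data \<Rightarrow> bool" where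
  "core_edge_data g x y \<longleftrightarrow>
     data_nat (left x) = 1 \<and> (data_nat (left y) = 0 \<and> closed_adj_data g (right x) (right y) \<or> data_nat (left y) = 2) \<or>
     data_nat (left x) = 3 \<and> data_nat (left y) = 2"

definition has_leaf_data :: "data \<Rightarrow> data \<Rightarrow> data \<Rightarrow> bool" where
  "has_leaf_data g x j \<longleftrightarrow>
     data_nat (left x) = 0 \<and> data_nat j = 0 \<or>
     data_nat (left x) = 1 \<and> \<not> closed_adj_data g (right x) j \<or>
     data_nat (left x) = 2 \<or>
     data_nat (left x) = 3 \<and> \<not> data_nat j = 0"

definition edge_data :: "data \<Rightarrow> data \<Rightarrow> data \<Rightarrow> bool" where
  "edge_data g p q \<longleftrightarrow> data_nat (left p) = 0 \<and>
     (data_nat (left q) = 0 \<and> core_edge_data g (right p) (right q) \<or>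
      \<not> data_nat (left q) = 0 \<and>
      data_nat (left (right p)) = data_nat (left (right q)) \<and>
      data_nat (right (right p)) = data_nat (right (right q)) \<and>
      has_leaf_data g (right p) (right (left q)))"

text \<open>The doubled \<open>map\<close> keeps the pattern of \<open>poly_time_upt\<close>
  visible.\<close>

definition cores_data :: "data \<Rightarrow> data list" where
  "cores_data g = [Cell (nat_data 3) Atom] @ map (Cell (nat_data 0)) (map nat_data [0..<data_nat g]) @
     map (Cell (nat_data 1)) (map nat_data [0..<data_nat g]) @
     map (Cell (nat_data 2)) (map nat_data [0..<data_nat g])"

text \<open>Two cells in front of \<open>g\<close> turn its length \<open>n\<close> into the
  \<open>n + 2\<close> of the leaves.\<close>

definition vertices_data :: "data \<Rightarrow> data list" where
  "vertices_data g = map (Cell Atom) (cores_data g) @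
     concat (map (\<lambda>x. map (\<lambda>j. Cell (Cell Atom j) x)
       (map nat_data [0..<data_nat (Cell Atom (Cell Atom g))])) (cores_data g))"

definition reduction_data :: "data \<Rightarrow> data" where
  "reduction_data g = list_data (map (\<lambda>p. list_data
     (map (\<lambda>q. bit_data (edge_data g p q \<or> edge_data g q p)) (vertices_data g))) (vertices_data g))"

text \<open>The input pairs the graph, whose length supplies \<open>n\<close>, with the list of
  alliances. \<open>left s\<close> is the hub bit; once \<open>right s\<close> has removed it,
  position \<open>i\<close> belongs to \<open>Element i\<close>.\<close>

definition decode_data :: "data \<Rightarrow> data" where
  "decode_data z = list_data (map
     (\<lambda>s. list_data (map (\<lambda>i. nth_data (right s) (data_nat i)) (map nat_data [0..<data_nat (left z)])))
     (filter (\<lambda>s. left s \<noteq> Atom) (data_list (right z))))"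

text \<open>The list rules match on \<open>list_data\<close>; this brings an arbitrary tree into
  that form.\<close>

lemma poly_time_list_data_data_list: "poly_time g \<Longrightarrow> poly_time (\<lambda>x. list_data (data_list (g x)))"
  by simp

lemma poly_time_singleton: "poly_time g \<Longrightarrow> poly_time (\<lambda>x. list_data [g x])"
  by (simp add: poly_time_Cell poly_time_const)

lemma poly_time_cores_data: "poly_time (\<lambda>x. list_data (cores_data x))"
  unfolding cores_data_def
  by (intro poly_time_upt poly_time_singleton poly_time_intros)

lemma poly_time_vertices_data: "poly_time (\<lambda>x. list_data (vertices_data x))"
  unfolding vertices_data_def
  by (intro poly_time_upt poly_time_comp[OF poly_time_cores_data] poly_time_intros)

lemma poly_time_pred_edge_data:
  "poly_time f \<Longrightarrow> poly_time g \<Longrightarrow> poly_time h \<Longrightarrow> poly_time_pred (\<lambda>x. edge_data (f x) (g x) (h x))"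
  unfolding edge_data_def core_edge_data_def has_leaf_data_def closed_adj_data_def
  by (intro poly_time_intros)

lemma poly_time_reduction_data: "poly_time reduction_data"
  unfolding reduction_data_def
  by (intro poly_time_comp[OF poly_time_vertices_data] poly_time_pred_edge_data poly_time_intros)

lemma poly_time_decode_data: "poly_time decode_data"
  unfolding decode_data_def
  by (intro poly_time_list_data_data_list poly_time_upt poly_time_intros)

section \<open>Correctness of the encoded reduction and decoding\<close>

lemma data_nat_simps [simp]: "data_nat Atom = 0" "data_nat (Cell a b) = Suc (data_nat b)"
  by (simp_all add: data_nat_def)

lemma data_nat_list_data [simp]: "data_nat (list_data as) = length as"
  by (simp add: data_nat_def)

lemma data_nat_graph_data: "data_nat (graph_data G) = card (pverts G)"
  by (simp add: graph_data_def Let_def)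

text \<open>Agreement as lists matters, since adjacency matrices and characteristic vectors depend
  on the order of the vertices.\<close>

lemma map_vertex_data_vertices:
  "map vertex_data (vertices (data_nat g)) = vertices_data g"
proof -
  have cores: "map core_data (cores (data_nat g)) = cores_data g"
    by (simp add: cores_def cores_data_def)
  have "map vertex_data (concat (map (\<lambda>x. map (Leaf x) js) xs))
      = concat (map (\<lambda>x. map (\<lambda>j. Cell (Cell Atom j) x) (map nat_data js)) (map core_data xs))" for js xs
    by (induction xs) auto
  moreover have "map vertex_data (map Core xs) = map (Cell Atom) (map core_data xs)" for xs
    by simp
  ultimately show ?thesis
    by (simp add: vertices_def vertices_data_def cores[symmetric] del: upt_Suc map_map)
qed

text \<open>No range is imposed on \<open>v\<close> and \<open>w\<close>: leaf indices reach
  \<open>n + 1\<close>, where the lookup gives \<open>Atom\<close> just as \<open>parcs G\<close>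
  has no arc.\<close>

lemma nth_data_graph_data:
  assumes "input_graph G"
  shows "nth_data (nth_data (graph_data G) v) w \<noteq> Atom \<longleftrightarrow> (v, w) \<in> parcs G"
proof -
  obtain n where G: "pair_graph G" "pverts G = {..<n}"
    using assms by (auto simp: input_graph_def)
  interpret pair_graph G by (rule G)
  have "v < n" "w < n" if "(v, w) \<in> parcs G"
    using that in_arcsD1 in_arcsD2 G(2) by auto
  moreover have "nth_data Atom w = Atom"
    using nth_data_list_data[of "[]"] by simp
  ultimately show ?thesis
    by (auto simp: graph_data_def Let_def nth_data_list_data G(2))
qed

lemma closed_adj_data:
  "input_graph G \<Longrightarrow> closed_adj_data (graph_data G) (nat_data v) (nat_data w) \<longleftrightarrow> closed_adj G v w"
  by (simp add: closed_adj_data_def closed_adj_def nth_data_graph_data)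

lemma core_edge_data:
  "input_graph G \<Longrightarrow> core_edge_data (graph_data G) (core_data x) (core_data y) \<longleftrightarrow> core_edge G x y"
  by (cases x; cases y) (auto simp: core_edge_data_def closed_adj_data)

lemma has_leaf_data:
  "input_graph G \<Longrightarrow> has_leaf_data (graph_data G) (core_data x) (nat_data j) \<longleftrightarrow> has_leaf G x j"
  by (cases x) (auto simp: has_leaf_data_def closed_adj_data)

lemma core_data_inject:
  "data_nat (left (core_data x)) = data_nat (left (core_data y)) \<and>
   data_nat (right (core_data x)) = data_nat (right (core_data y)) \<longleftrightarrow> x = y"
  by (cases x; cases y) auto

lemma edge_data:
  assumes "input_graph G"
  shows "edge_data (graph_data G) (vertex_data p) (vertex_data q) \<longleftrightarrow> edge G p q"
  using core_data_inject
  by (cases p; cases q) (auto simp: edge_data_def core_edge_data has_leaf_data assms)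

lemma graph_data_index_graph:
  "graph_data (index_graph vs H) =
     list_data (map (\<lambda>p. list_data (map (\<lambda>q. bit_data ((p, q) \<in> parcs H)) vs)) vs)"
proof -
  have "map (\<lambda>v. bit_data ((u, v) \<in> parcs (index_graph vs H))) [0..<length vs]
      = map (\<lambda>q. bit_data ((vs ! u, q) \<in> parcs H)) vs" if "u < length vs" for u
    using that by (intro nth_equalityI) (auto simp: index_graph_def)
  then have "map (\<lambda>u. list_data (map (\<lambda>v. bit_data ((u, v) \<in> parcs (index_graph vs H))) [0..<length vs])) [0..<length vs]
      = map (\<lambda>p. list_data (map (\<lambda>q. bit_data ((p, q) \<in> parcs H)) vs)) vs"
    by (intro nth_equalityI) auto
  then show ?thesis
    by (simp add: graph_data_def index_graph_def Let_def)
qed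

lemma reduction_data_graph_data:
  assumes "input_graph G"
  shows "reduction_data (graph_data G) = graph_data (reduced_graph G)"
proof -
  let ?vs = "vertices (card (pverts G))"
  have "vertices_data (graph_data G) = map vertex_data ?vs"
    using map_vertex_data_vertices[of "graph_data G"] by (simp add: data_nat_graph_data)
  moreover have "(p, q) \<in> parcs (reduction_graph G) \<longleftrightarrow> edge G p q \<or> edge G q p"
    if "p \<in> set ?vs" "q \<in> set ?vs" for p q
    using that by (simp add: parcs_reduction_graph pverts_reduction_graph)
  ultimately show ?thesis
    unfolding reduction_data_def reduced_graph_def graph_data_index_graph
    by (auto simp: edge_data[OF assms] comp_def intro!: map_cong arg_cong[of _ _ list_data])
qed

lemma left_list_data: "left (list_data as) = (if as = [] then Atom else hd as)"
  by (cases as) auto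

lemma right_list_data: "right (list_data as) = list_data (tl as)"
  by (cases as) auto

lemma (in dominating_set_instance) decode_data:
  "decode_data (Cell (graph_data G) (list_data (map (vertex_set_data (reduced_graph G)) Xs)))
     = list_data (map (vertex_set_data G) (map decode (filter (\<lambda>X. 0 \<in> X) Xs)))"
proof -
  have card: "card (pverts (reduced_graph G)) = length vs"
    by (simp add: reduced_graph_eq index_graph_def)
  have "0 < length vs"
    using length_vertices_gt by linarith
  then have left: "left (vertex_set_data (reduced_graph G) X) \<noteq> Atom \<longleftrightarrow> 0 \<in> X" for X
    by (simp add: vertex_set_data_def card left_list_data hd_map)
  have "nth_data (right (vertex_set_data (reduced_graph G) X)) i = bit_data (i \<in> decode X)"
    if "i < n" for X i
  proof -
    have "i < length vs - 1"
      using that length_vertices_gt by linarith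
    then show ?thesis
      using that
      by (simp add: vertex_set_data_def card right_list_data nth_data_list_data nth_tl map_tl[symmetric]
          decode_def)
  qed
  then have "list_data (map (\<lambda>i. nth_data (right (vertex_set_data (reduced_graph G) X)) (data_nat i))
      (map nat_data [0..<n])) = vertex_set_data G (decode X)" for X
    by (simp add: vertex_set_data_def verts comp_def)
  then show ?thesis
    by (simp add: decode_data_def data_nat_graph_data verts filter_map left comp_def)
qed

text \<open>Together with the number of solutions this bounds the size of the decoder's input; a
  running time would not, because of sharing.\<close>

lemma size_vertex_set_data: "size (vertex_set_data G X) \<le> 2 * card (pverts G)"
proof -
  have "size (list_data (map (\<lambda>v. bit_data (v \<in> X)) [0..<card (pverts G)]))
      \<le> length (map (\<lambda>v. bit_data (v \<in> X)) [0..<card (pverts G)]) * (1 + 1)"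
    by (rule size_list_data_le) (auto simp: bit_data_def)
  then show ?thesis
    by (simp add: vertex_set_data_def)
qed

lemma card_pverts_le_size: "card (pverts G) \<le> size (graph_data G)"
  using length_data_list_le[of "graph_data G"] data_nat_graph_data[of G]
  by (simp add: data_nat_def)

theorem theorem5:
  assumes "\<exists>c. output_polynomial_vertex_set_enumeration
                 bipartite globally_minimal_defensive_alliance c"
  shows "\<exists>c. output_polynomial_vertex_set_enumeration
               (\<lambda>G. Digraph_Component.connected (with_proj G)) minimal_dominating_set c"
proof -
  let ?sol = "\<lambda>G. {X. globally_minimal_defensive_alliance G X}"
  let ?mds = "\<lambda>G. {D. minimal_dominating_set G D}"
  obtain c p where c: "\<And>G. input_graph G \<Longrightarrow> bipartite G \<Longrightarrow> \<exists>Xs t. distinct Xs \<and> set Xs = ?sol G \<and>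
        computes_in_time c (graph_data G) (list_data (map (vertex_set_data G) Xs)) t \<and>
        t \<le> poly (poly p [:card (?sol G):]) (size (graph_data G))"
    using assms unfolding output_polynomial_vertex_set_enumeration_def output_polynomial_enumeration_def
    by blast
  \<comment> \<open>The identity program, paired with the enumeration, carries the graph over to the
    decoder, which has to know \<open>n\<close>.\<close>
  obtain c0 T0 where c0: "\<And>x. computes_in_time c0 x x (T0 x)" "poly_bounded UNIV size T0"
    using poly_time_id by (rule poly_timeE) blast
  obtain c1 T1 where c1: "\<And>x. computes_in_time c1 x (reduction_data x) (T1 x)"
      "poly_bounded UNIV size T1" "poly_bounded UNIV size (\<lambda>x. size (reduction_data x))"
    using poly_time_reduction_data by (rule poly_timeE) blast
  obtain c2 T2 where c2: "\<And>x. computes_in_time c2 x (decode_data x) (T2 x)"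
      "poly_bounded UNIV size T2"
    using poly_time_decode_data by (rule poly_timeE) blast
  obtain d1 K1 where d1: "\<And>x y z t1 t2. computes_in_time c1 x y t1 \<Longrightarrow> computes_in_time c y z t2
      \<Longrightarrow> computes_in_time d1 x z (t1 + t2 + K1)"
    using computes_seq[of c1 c] by blast
  obtain d2 K2 where d2: "\<And>x y z t1 t2. computes_in_time c0 x y t1 \<Longrightarrow> computes_in_time d1 x z t2
      \<Longrightarrow> computes_in_time d2 x (Cell y z) (t1 + t2 + K2)"
    using computes_pair[of c0 d1] by blast
  obtain d3 K3 where d3: "\<And>x y z t1 t2. computes_in_time d2 x y t1 \<Longrightarrow> computes_in_time c2 y z t2
      \<Longrightarrow> computes_in_time d3 x z (t1 + t2 + K3)"
    using computes_seq[of d2 c2] by blast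
  obtain k where k: "\<And>x. T2 x \<le> (size x + 2) ^ k"
    using c2(2) unfolding poly_bounded_def by blast

  let ?I = "{G. input_graph G \<and> Digraph_Component.connected (with_proj G)}"
  \<comment> \<open>\<open>s\<close> and \<open>m\<close> are size and solution count of the reduced
    instance, \<open>t\<close> the time granted to \<open>c\<close> on it, and \<open>u\<close> a
    bound for decoding.\<close>
  define s where "s G = size (reduction_data (graph_data G))" for G
  define m where "m G = card (?sol (reduced_graph G))" for G
  define t where "t G = poly (poly p [:m G:]) (s G)" for G
  \<comment> \<open>\<open>2 * s G + 1\<close> per alliance is its vector and a list cell; the 3 is
    the pairing cell and the shift by 2 in the bound for \<open>T2\<close>.\<close>
  define u where "u G = (size (graph_data G) + m G * (2 * s G + 1) + 3) ^ k" for G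
  define T where "T G = T0 (graph_data G) + (T1 (graph_data G) + t G + K1) + K2 + u G + K3" for G
  have run: "\<exists>Ds t. distinct Ds \<and> set Ds = ?mds G \<and>
      computes_in_time d3 (graph_data G) (list_data (map (vertex_set_data G) Ds)) t \<and> t \<le> T G"
    and m: "m G \<le> s G + card (?mds G)" if "G \<in> ?I" for G
  proof -
    have G: "input_graph G"
      using that by simp
    then obtain n where "pair_graph G" "pverts G = {..<n}"
      by (auto simp: input_graph_def)
    then interpret dominating_set_instance G n
      by (rule dominating_set_instance.intro)
    let ?x = "graph_data G"
    have red: "reduction_data ?x = graph_data (reduced_graph G)"
      by (rule reduction_data_graph_data[OF G])
    have verts_le: "card (pverts (reduced_graph G)) \<le> s G"
      unfolding s_def red by (rule card_pverts_le_size)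
    then show "m G \<le> s G + card (?mds G)"
      using card_minimal_alliances by (simp add: m_def reduced_graph_eq index_graph_def)
    obtain Xs t' where Xs: "distinct Xs" "set Xs = ?sol (reduced_graph G)"
        and run: "computes_in_time c (reduction_data ?x)
          (list_data (map (vertex_set_data (reduced_graph G)) Xs)) t'"
        and t': "t' \<le> t G"
      using c[OF input_graph_reduced_graph[of G] bipartite_reduced_graph[of G]]
      unfolding red[symmetric] t_def m_def s_def by blast
    define z where "z = list_data (map (vertex_set_data (reduced_graph G)) Xs)"
    have "computes_in_time d3 ?x (decode_data (Cell ?x z))
        (T0 ?x + (T1 ?x + t' + K1) + K2 + T2 (Cell ?x z) + K3)"
      unfolding z_def by (intro d3[OF d2[OF c0(1) d1[OF c1(1) run]] c2(1)])
    moreover define Ds where "Ds = map decode (filter (\<lambda>X. 0 \<in> X) Xs)"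
    then have "decode_data (Cell ?x z) = list_data (map (vertex_set_data G) Ds)"
      unfolding z_def by (simp only: decode_data)
    moreover have "set (filter (\<lambda>X. 0 \<in> X) Xs)
        = {X. globally_minimal_defensive_alliance (reduced_graph G) X \<and> 0 \<in> X}"
      by (auto simp: Xs)
    then have "distinct Ds" "set Ds = ?mds G"
      using bij_betw_decode Xs(1) unfolding Ds_def bij_betw_def
      by (simp_all only: distinct_map set_map distinct_filter)
    moreover have "T2 (Cell ?x z) \<le> u G"
    proof -
      have "length Xs = m G"
        using distinct_card[OF Xs(1)] by (simp add: Xs(2) m_def)
      moreover have "size z \<le> length (map (vertex_set_data (reduced_graph G)) Xs) * (2 * s G + 1)"
        unfolding z_def
      proof (rule size_list_data_le)
        fix a assume "a \<in> set (map (vertex_set_data (reduced_graph G)) Xs)"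
        then obtain X where "a = vertex_set_data (reduced_graph G) X"
          by auto
        then show "size a \<le> 2 * s G"
          using size_vertex_set_data[of "reduced_graph G" X] verts_le by simp
      qed
      ultimately have "(size (Cell ?x z) + 2) ^ k \<le> u G"
        unfolding u_def by (intro power_mono) simp_all
      then show ?thesis
        using k le_trans by blast
    qed
    then have "T0 ?x + (T1 ?x + t' + K1) + K2 + T2 (Cell ?x z) + K3 \<le> T G"
      unfolding T_def using t' by simp
    ultimately show "\<exists>Ds t. distinct Ds \<and> set Ds = ?mds G \<and>
        computes_in_time d3 ?x (list_data (map (vertex_set_data G) Ds)) t \<and> t \<le> T G"
      by metis
  qed
  have "poly_bounded ?I (\<lambda>G. card (?mds G) + size (graph_data G)) T"
  proof -
    let ?\<mu> = "\<lambda>G. card (?mds G) + size (graph_data G)"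
    have x: "poly_bounded ?I ?\<mu> (\<lambda>G. size (graph_data G))"
      and D: "poly_bounded ?I ?\<mu> (\<lambda>G. card (?mds G))"
      by (rule poly_bounded_mono[OF poly_bounded_measure]; simp)+
    have s: "poly_bounded ?I ?\<mu> s"
      unfolding s_def by (rule poly_bounded_comp[OF c1(3) x])
    \<comment> \<open>The number of alliances, on which the time of \<open>c\<close> depends, is
      traded for the number of dominating sets.\<close>
    have m: "poly_bounded ?I ?\<mu> m"
      by (rule poly_bounded_mono[OF poly_bounded_add[OF s D] m])
    show ?thesis
      unfolding T_def t_def u_def
      by (intro poly_bounded_intros poly_bounded_poly_poly poly_bounded_power
          poly_bounded_comp[OF c0(2) x] poly_bounded_comp[OF c1(2) x] s m x)
  qed
  then obtain q :: "nat poly poly" where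
    q: "\<And>G. G \<in> ?I \<Longrightarrow> T G \<le> poly (poly q [:card (?mds G):]) (size (graph_data G))"
    by (rule poly_bounded_imp_poly_poly) blast
  have "output_polynomial_vertex_set_enumeration
      (\<lambda>G. Digraph_Component.connected (with_proj G)) minimal_dominating_set d3"
    unfolding output_polynomial_vertex_set_enumeration_def output_polynomial_enumeration_def
    using run q by (meson le_trans)
  then show ?thesis
    by blast
qed

end
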